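(* Let $f(y)=J\nabla H(y)$, where $H$ is a sufficiently smooth scalar function of $y\in\mathbb{R}^{2m}$ and $J=\begin{pmatrix}0&I_m\\-I_m&0\end{pmatrix}$, and let $r\ge1$ be an integer and $h>0$ the stepsize. Let $\omega(t_0+ch)$ and $y(t_0+ch)$, $c\in[0,1]$, be the solutions of $$\omega'(t_0+ch)=\sum_{j=0}^{r-1}(2j+1)P_j(c)\int_0^1P_j(\tau)\,f(\omega(t_0+\tau h))\,\mathrm{d}\tau,\quad c\in[0,1],\qquad \omega(t_0)=y_0,$$ and $$y'(t_0+ch)=\sum_{j=0}^{\infty}(2j+1)P_j(c)\int_0^1P_j(\tau)\,f(y(t_0+\tau h))\,\mathrm{d}\tau,\quad c\in[0,1],\qquad y(t_0)=y_0,$$ respectively. Then $$y(t_0+h)-\omega(t_0+h)=O(h^{2r+1}).$$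
   Context: $P_j$, $j\ge0$, are the shifted Legendre polynomials on $[0,1]$, $P_j(t)=\frac{1}{j!}\frac{\mathrm{d}^j}{\mathrm{d}t^j}\left[(t^2-t)^j\right]$, which satisfy $\int_0^1P_i(t)P_j(t)\,\mathrm{d}t=\frac{1}{2i+1}\delta_{ij}$. The prime denotes the derivative with respect to the time argument $t$, evaluated at $t=t_0+ch$. The right-hand side of the equation for $y$ is the Fourier-Legendre expansion of $c\mapsto f(y(t_0+ch))$, so that $y$ is the solution of $y'(t)=f(y(t))$, $y(t_0)=y_0$, on $[t_0,t_0+h]$; the equation for $\omega$ is obtained by truncating this series after $r$ terms. Equivalently, $\omega(t_0+ch)=y_0+h\sum_{j=0}^{r-1}(2j+1)\int_0^cP_j(x)\,\mathrm{d}x\int_0^1P_j(\tau)f(\omega(t_0+\tau h))\,\mathrm{d}\tau$.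
   Formalization: The solutions ω, one for each small stepsize h, are additionally assumed bounded uniformly in h: the equation for ω may have other solutions that blow up as h→0 (e.g. H(q,p)=pq², r=1, q(t_0)=1), and for these the claimed estimate fails. *)

theory Defs
  imports "HOL-Analysis.Analysis" "HOL-Library.Landau_Symbols"
begin

definition shifted_legendre :: "nat \<Rightarrow> real \<Rightarrow> real" where
  "shifted_legendre j t = (deriv ^^ j) (\<lambda>x. (x\<^sup>2 - x) ^ j) t / fact j"

text \<open>On a finite-dimensional domain, the class of k times continuously differentiable functions
  is obtained by iterating directional derivatives of everywhere differentiable functions.\<close>

primrec C_k :: "nat \<Rightarrow> ('a::euclidean_space \<Rightarrow> 'b::real_normed_vector) \<Rightarrow> bool" where
  "C_k 0 g \<longleftrightarrow> continuous_on UNIV g"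
| "C_k (Suc k) g \<longleftrightarrow>
     (\<forall>x. g differentiable (at x)) \<and> (\<forall>v. C_k k (\<lambda>x. frechet_derivative g (at x) v))"

definition gradient :: "('a::euclidean_space \<Rightarrow> real) \<Rightarrow> 'a \<Rightarrow> 'a" where
  "gradient H y = (THE D. GDERIV H y :> D)"

lemma gradient_works:
  assumes "H differentiable (at y)"
  shows "GDERIV H y :> gradient H y"
proof -
  obtain A where A: "(H has_derivative A) (at y)"
    using assms unfolding differentiable_def by blast
  then have lin: "linear A"
    by (rule has_derivative_linear)
  define D where "D = adjoint A 1"
  have "A x = x \<bullet> D" for x
    unfolding D_def by (simp add: adjoint_works[OF lin])
  then have "A = (\<lambda>x. x \<bullet> D)" by auto
  with A have D: "GDERIV H y :> D" by (simp add: gderiv_def)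
  have "D' = D" if "GDERIV H y :> D'" for D'
    using has_derivative_unique[OF that[unfolded gderiv_def] D[unfolded gderiv_def]]
    by (metis inner_commute vector_eq_ldot)
  with D show ?thesis
    unfolding gradient_def by (metis theI)
qed

text \<open>Phase space has the index type \<open>'m + 'm\<close> (dimension \<open>2 * CARD('m)\<close>): \<open>Inl\<close> indexes the
  first half of the coordinates and \<open>Inr\<close> the second.\<close>

definition symplectic_J :: "real ^ ('m::finite + 'm) ^ ('m + 'm)" where
  "symplectic_J = (\<chi> i j. case (i, j) of
     (Inl a, Inr b) \<Rightarrow> (if a = b then 1 else 0)
   | (Inr a, Inl b) \<Rightarrow> (if a = b then - 1 else 0)
   | _ \<Rightarrow> 0)"

text \<open>The j-th term, at \<open>c\<close>, of the Fourier-Legendre expansion of \<open>c \<mapsto> f (u (t0 + c * h))\<close>.\<close>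

definition legendre_term ::
    "('a::euclidean_space \<Rightarrow> 'a) \<Rightarrow> real \<Rightarrow> real \<Rightarrow> (real \<Rightarrow> 'a) \<Rightarrow> real \<Rightarrow> nat \<Rightarrow> 'a" where
  "legendre_term f t0 h u c j =
     ((2 * real j + 1) * shifted_legendre j c) *\<^sub>R
       integral {0..1} (\<lambda>\<tau>. shifted_legendre j \<tau> *\<^sub>R f (u (t0 + \<tau> * h)))"

definition truncated_solution ::
    "('a::euclidean_space \<Rightarrow> 'a) \<Rightarrow> nat \<Rightarrow> real \<Rightarrow> 'a \<Rightarrow> real \<Rightarrow> (real \<Rightarrow> 'a) \<Rightarrow> bool" where
  "truncated_solution f r t0 y0 h w \<longleftrightarrow> w t0 = y0 \<and>
     (\<forall>c\<in>{0..1}. (w has_vector_derivative (\<Sum>j<r. legendre_term f t0 h w c j))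
        (at (t0 + c * h) within {t0..t0 + h}))"

definition series_solution ::
    "('a::euclidean_space \<Rightarrow> 'a) \<Rightarrow> real \<Rightarrow> 'a \<Rightarrow> real \<Rightarrow> (real \<Rightarrow> 'a) \<Rightarrow> bool" where
  "series_solution f t0 y0 h y \<longleftrightarrow> y t0 = y0 \<and>
     (\<forall>c\<in>{0..1}. \<exists>d. legendre_term f t0 h y c sums d \<and>
        (y has_vector_derivative d) (at (t0 + c * h) within {t0..t0 + h}))"

end

theory Submission
  imports Defs "HOL-Computational_Algebra.Polynomial"
begin

text \<open>
  Time is rescaled to \<open>c \<in> [0,1]\<close>, so that \<open>d/dc\<close> is \<open>h\<close> times the time derivative. Write
  \<open>X\<close> and \<open>Y\<close> for the rescaled \<open>\<omega>\<close> and \<open>y\<close>, and \<open>\<Pi>\<close> for the \<open>L\<^sup>2\<close>-orthogonal projection onto the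
  polynomials of degree less than \<open>r\<close>, which is what truncating a Fourier-Legendre series after \<open>r\<close>
  terms computes. Then \<open>X' = h \<Pi> (f \<circ> X)\<close>.

  Also \<open>Y' = h f(Y)\<close>. The hypothesis only says that \<open>Y' / h\<close> is the pointwise sum of the
  Legendre series of the continuous function \<open>f \<circ> Y\<close>. That series converges to \<open>f \<circ> Y\<close> in
  \<open>L\<^sup>2\<close>, so by Fatou's lemma the pointwise sum agrees with \<open>f \<circ> Y\<close> almost everywhere, and the
  fundamental theorem of calculus for the Henstock-Kurzweil integral turns the equation almost everywhere
  into one that holds everywhere.

  The error \<open>e = Y - X\<close> satisfies \<open>e' = h (f(Y) - f(X) + \<rho>)\<close> with the residual
  \<open>\<rho> = f(X) - \<Pi> (f \<circ> X)\<close>, which is orthogonal to every polynomial of degree less than \<open>r\<close>. If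
  \<open>f \<circ> X\<close> has \<open>r\<close> time derivatives that are bounded uniformly in \<open>h\<close>, then \<open>\<rho> = O(h ^ r)\<close>, hence
  \<open>e = O(h ^ (r + 1))\<close> on the whole interval. Orthogonality doubles the order at
  the end point: integrating \<open>\<rho>\<close> against any function with \<open>r\<close> uniformly bounded time derivatives gains a
  further factor \<open>h ^ r\<close>, because such a function is a polynomial of degree less than \<open>r\<close> up to
  \<open>O(h ^ r)\<close> (\<open>smooth_family_orthogonal_bound\<close>).

  What must be tested against \<open>\<rho>\<close> is, in principle, the adjoint of the linearized flow. The adjoint
  equation need not be solved: \<open>f(Y) - f(X) = A e + O(h ^ (2 r))\<close> with the Jacobian \<open>A = f'(Y)\<close>, and an
  integral of \<open>q \<bullet> e\<close> is turned, by integration by parts and insertion of the differential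
  equation, into a term of the size \<open>O(h ^ (2 r))\<close> and the integral of \<open>q\<^sub>1 \<bullet> e\<close> with a \<open>q\<^sub>1\<close> that
  is smaller than \<open>q\<close> by a factor \<open>h\<close>. Since \<open>e = O(h ^ (r + 1))\<close> already, \<open>r - 1\<close> repetitions suffice
  (\<open>error_moment_bound\<close>). The integration by parts makes up for the derivative that is lost in passing from \<open>f\<close>
  to \<open>A\<close>, so that \<open>f\<close> of class \<open>C\<^sup>r\<close> is enough.

  Uniform smoothness is expressed by the predicate \<open>smooth_family\<close>. It is closed under
  products, under composition with \<open>C_k\<close> maps, and, by the decay of Legendre coefficients, under \<open>\<Pi>\<close>;
  so the equations for \<open>X\<close> and \<open>Y\<close> raise the order of smoothness one by one from mere boundedness
  (\<open>smooth_family_bootstrap\<close>). The Hamiltonian structure enters only through the fact that the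
  components of \<open>J \<nabla>H\<close> are directional derivatives of \<open>H\<close>.
\<close>

section \<open>Shifted Legendre polynomials\<close>

lemma integrable_poly_mult:
  "continuous_on {0..1} u \<Longrightarrow> (\<lambda>x. poly p x * u x) integrable_on {0..1::real}"
  by (intro integrable_continuous_real continuous_intros)

lemma integral_pderiv_mult:
  fixes p q :: "real poly"
  assumes "poly p 0 = 0" "poly p 1 = 0"
  shows "integral {0..1} (\<lambda>x. poly (pderiv p) x * poly q x) =
         - integral {0..1} (\<lambda>x. poly p x * poly (pderiv q) x)"
proof -
  have "((\<lambda>x. poly (pderiv (p * q)) x) has_integral (poly (p * q) 1 - poly (p * q) 0)) {0..1}"
    by (intro fundamental_theorem_of_calculus)
      (auto simp: has_real_derivative_iff_has_vector_derivative[symmetric] simp del: poly_mult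
        intro!: DERIV_subset[OF poly_DERIV])
  then have "integral {0..1} (\<lambda>x. poly p x * poly (pderiv q) x + poly (pderiv p) x * poly q x) = 0"
    using assms by (simp add: pderiv_mult integral_unique mult_ac)
  moreover have "integral {0..1} (\<lambda>x. poly p x * poly (pderiv q) x + poly (pderiv p) x * poly q x) =
      integral {0..1} (\<lambda>x. poly p x * poly (pderiv q) x) +
      integral {0..1} (\<lambda>x. poly (pderiv p) x * poly q x)"
    by (intro integral_add integrable_poly_mult continuous_intros)
  ultimately show ?thesis by simp
qed

text \<open>Each differentiation costs at most one factor \<open>p\<close>. For \<open>p = x\<^sup>2 - x\<close> this makes all boundary terms
vanish when the Rodrigues formula is integrated by parts.\<close>

lemma power_dvd_higher_pderiv:
  fixes p :: "real poly"
  shows "i \<le> n \<Longrightarrow> p ^ (n - i) dvd (pderiv ^^ i) (p ^ n)"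
proof (induction i)
  case (Suc i)
  then obtain s where s: "(pderiv ^^ i) (p ^ n) = p ^ (n - i) * s" by (auto elim: dvdE)
  have ni: "n - i = Suc (n - Suc i)" using Suc.prems by simp
  have "(pderiv ^^ Suc i) (p ^ n) = p ^ (n - Suc i) *
      (p * pderiv s + smult (of_nat (Suc (n - Suc i))) (pderiv p) * s)"
    unfolding funpow.simps comp_def s ni pderiv_mult pderiv_power_Suc
    by (simp add: algebra_simps del: of_nat_Suc)
  then show ?case by simp
qed simp

text \<open>Integration by parts \<open>n\<close> times moves all derivatives of the Rodrigues formula onto \<open>q\<close>; orthogonality to
low degrees and the value of the norm are both read off from this identity.\<close>

lemma integral_rodrigues:
  fixes q :: "real poly" and n :: nat
  defines "W \<equiv> [:0, -1, 1:] ^ n"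
  shows "integral {0..1} (\<lambda>x. poly ((pderiv ^^ n) W) x * poly q x) =
         (-1) ^ n * integral {0..1} (\<lambda>x. poly W x * poly ((pderiv ^^ n) q) x)"
proof -
  have "integral {0..1} (\<lambda>x. poly ((pderiv ^^ n) W) x * poly q x) =
      (-1) ^ i * integral {0..1} (\<lambda>x. poly ((pderiv ^^ (n - i)) W) x * poly ((pderiv ^^ i) q) x)"
    if "i \<le> n" for i
    using that
  proof (induction i)
    case (Suc i)
    have ni: "n - i = Suc (n - Suc i)" using Suc.prems by simp
    have "[:0, -1, 1:] dvd [:0, -1, 1::real:] ^ (n - (n - Suc i))"
      using Suc.prems by (intro dvd_power) auto
    also have "\<dots> dvd (pderiv ^^ (n - Suc i)) W"
      unfolding W_def by (rule power_dvd_higher_pderiv) simp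
    finally obtain s where s: "(pderiv ^^ (n - Suc i)) W = [:0, -1, 1:] * s" by (elim dvdE)
    have "integral {0..1} (\<lambda>x. poly ((pderiv ^^ (n - i)) W) x * poly ((pderiv ^^ i) q) x) =
        - integral {0..1} (\<lambda>x. poly ((pderiv ^^ (n - Suc i)) W) x * poly ((pderiv ^^ Suc i) q) x)"
      unfolding ni funpow.simps comp_def by (rule integral_pderiv_mult) (simp_all add: s)
    then show ?case using Suc by simp
  qed simp
  from this[of n] show ?thesis by simp
qed

definition legendre_poly :: "nat \<Rightarrow> real poly" where
  "legendre_poly n = smult (1 / fact n) ((pderiv ^^ n) ([:0, -1, 1:] ^ n))"

lemma higher_deriv_poly: "(deriv ^^ n) (poly p) = poly ((pderiv ^^ n) p)" for p :: "real poly"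
proof (induction n)
  case (Suc n)
  then show ?case by (auto intro!: DERIV_imp_deriv)
qed simp

lemma shifted_legendre_eq_poly: "shifted_legendre n = poly (legendre_poly n)"
proof -
  have "(\<lambda>x::real. (x\<^sup>2 - x) ^ n) = poly ([:0, -1, 1:] ^ n)"
    by (auto simp: power2_eq_square algebra_simps)
  then show ?thesis
    by (auto simp: shifted_legendre_def legendre_poly_def higher_deriv_poly)
qed

lemma continuous_on_shifted_legendre [continuous_intros]:
  "continuous_on S u \<Longrightarrow> continuous_on S (\<lambda>x. shifted_legendre j (u x))"
  unfolding shifted_legendre_eq_poly by (intro continuous_intros)

lemma degree_higher_pderiv: "degree ((pderiv ^^ i) p) = degree p - i" for p :: "real poly"
  by (induction i) (auto simp: degree_pderiv)

lemma coeff_higher_pderiv: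
  "coeff ((pderiv ^^ m) p) n = fact (n + m) / fact n * coeff p (n + m)" for p :: "real poly"
proof (induction m arbitrary: n)
  case (Suc m)
  have "coeff ((pderiv ^^ Suc m) p) n = real (Suc n) * coeff ((pderiv ^^ m) p) (Suc n)"
    by (simp add: coeff_pderiv)
  also have "\<dots> = fact (n + Suc m) / fact n * coeff p (n + Suc m)"
    unfolding Suc.IH by (simp add: divide_simps)
  finally show ?case .
qed simp

lemma coeff_square_minus_id_power: "coeff ([:0, -1, 1::real:] ^ n) (2 * n) = 1"
  "degree ([:0, -1, 1::real:] ^ n) = 2 * n"
proof -
  show d: "degree ([:0, -1, 1::real:] ^ n) = 2 * n" by (simp add: degree_power_eq)
  have "lead_coeff ([:0, -1, 1::real:] ^ n) = 1" by (simp add: lead_coeff_power)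
  then show "coeff ([:0, -1, 1::real:] ^ n) (2 * n) = 1" using d by simp
qed

lemma degree_legendre_poly: "degree (legendre_poly n) = n"
  by (simp add: legendre_poly_def degree_higher_pderiv coeff_square_minus_id_power)

lemma lead_coeff_legendre_poly: "coeff (legendre_poly n) n = fact (2 * n) / (fact n)\<^sup>2"
  using coeff_square_minus_id_power(1)[of n]
  by (simp add: legendre_poly_def coeff_higher_pderiv mult_2 power2_eq_square)

lemma shifted_legendre_orthogonal_poly:
  assumes "degree q < n"
  shows "integral {0..1} (\<lambda>x. shifted_legendre n x * poly q x) = 0"
proof -
  have "degree ((pderiv ^^ (n - 1)) q) = 0" using assms by (simp add: degree_higher_pderiv)
  then have "pderiv ((pderiv ^^ (n - 1)) q) = 0" by (simp add: pderiv_eq_0_iff)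
  moreover have "(pderiv ^^ n) q = pderiv ((pderiv ^^ (n - 1)) q)"
    using assms by (cases n) auto
  ultimately have "(pderiv ^^ n) q = 0" by simp
  then show ?thesis
    using integral_rodrigues[of n q]
    by (simp add: shifted_legendre_eq_poly legendre_poly_def mult.assoc)
qed

lemma shifted_legendre_orthogonal:
  "i \<noteq> j \<Longrightarrow> integral {0..1} (\<lambda>x. shifted_legendre i x * shifted_legendre j x) = 0"
  using shifted_legendre_orthogonal_poly[of "legendre_poly j" i]
    shifted_legendre_orthogonal_poly[of "legendre_poly i" j]
  by (cases i j rule: linorder_cases)
    (auto simp: degree_legendre_poly shifted_legendre_eq_poly mult.commute)

text \<open>The integral is the Beta function at \<open>(n + 1, n + 1)\<close>.\<close>

lemma integral_parabola_power:
  "integral {0..1} (\<lambda>x::real. (x - x\<^sup>2) ^ n) = (fact n)\<^sup>2 / fact (2 * n + 1)"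
proof -
  have "((\<lambda>t::real. t powr (real (Suc n) - 1) * (1 - t) powr (real (Suc n) - 1)) has_integral
      Beta (real (Suc n)) (real (Suc n))) {0..1}"
    by (rule has_integral_Beta_real) auto
  moreover have "Beta (real (Suc n)) (real (Suc n)) = (fact n)\<^sup>2 / fact (2 * n + 1)"
  proof -
    have sum: "real (Suc n) + real (Suc n) = 1 + real (2 * n + 1)" "real (Suc n) = 1 + real n"
      by simp_all
    show ?thesis
      unfolding Beta_def sum(1) unfolding sum(2) Gamma_fact by (simp only: power2_eq_square)
  qed
  ultimately have "((\<lambda>t::real. t powr n * (1 - t) powr n) has_integral
      (fact n)\<^sup>2 / fact (2 * n + 1)) {0..1}" by simp
  then have "((\<lambda>x::real. (x - x\<^sup>2) ^ n) has_integral (fact n)\<^sup>2 / fact (2 * n + 1)) {0..1}"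
  proof (rule has_integral_spike_finite[rotated 2])
    show "finite {0, 1::real}" by simp
    fix x :: real assume "x \<in> {0..1} - {0, 1}"
    then show "(x - x\<^sup>2) ^ n = x powr n * (1 - x) powr n"
      by (simp add: powr_realpow power_mult_distrib[symmetric] power2_eq_square algebra_simps)
  qed
  then show ?thesis by (rule integral_unique)
qed

text \<open>Applied to the Legendre polynomial itself, \<open>integral_rodrigues\<close> leaves the
constant \<open>(2 n)! / n!\<close> times a Beta integral.\<close>

lemma integral_shifted_legendre_square:
  "integral {0..1} (\<lambda>x. shifted_legendre n x * shifted_legendre n x) = 1 / (2 * real n + 1)"
proof -
  define W :: "real poly" where "W = [:0, -1, 1:] ^ n"
  have fact_double: "fact (2 * n + 1) = (2 * real n + 1) * fact (2 * n)" by simp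
  have "degree ((pderiv ^^ n) (legendre_poly n)) = 0"
    by (simp add: degree_higher_pderiv degree_legendre_poly)
  then obtain a where a: "(pderiv ^^ n) (legendre_poly n) = [:a:]" by (elim degree_eq_zeroE)
  have "a = coeff ((pderiv ^^ n) (legendre_poly n)) 0" by (simp add: a)
  also have "\<dots> = fact (2 * n) / fact n"
    by (simp add: coeff_higher_pderiv lead_coeff_legendre_poly power2_eq_square)
  finally have const: "(pderiv ^^ n) (legendre_poly n) = [:fact (2 * n) / fact n:]"
    by (simp add: a)
  have "integral {0..1} (\<lambda>x. shifted_legendre n x * shifted_legendre n x) =
      1 / fact n * integral {0..1} (\<lambda>x. poly ((pderiv ^^ n) W) x * poly (legendre_poly n) x)"
    unfolding integral_mult_right[symmetric]
    by (simp add: shifted_legendre_eq_poly legendre_poly_def W_def mult_ac)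
  also have "\<dots> = 1 / fact n * ((-1) ^ n *
      integral {0..1} (\<lambda>x. poly W x * (fact (2 * n) / fact n)))"
    using integral_rodrigues[of n "legendre_poly n"] by (simp add: W_def const)
  also have "integral {0..1} (\<lambda>x. poly W x * (fact (2 * n) / fact n)) =
      (-1) ^ n * (fact (2 * n) / fact n) * integral {0..1} (\<lambda>x::real. (x - x\<^sup>2) ^ n)"
    unfolding integral_mult_right[symmetric] W_def
    by (intro integral_cong)
      (simp add: power_mult_distrib[symmetric] power2_eq_square algebra_simps)
  finally show ?thesis
    unfolding integral_parabola_power fact_double
    by (simp add: power2_eq_square flip: power_mult_distrib)
qed

section \<open>Truncated Legendre expansions\<close>

definition legendre_coeff :: "(real \<Rightarrow> real) \<Rightarrow> nat \<Rightarrow> real" where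
  "legendre_coeff u j = integral {0..1} (\<lambda>x. shifted_legendre j x * u x)"

definition legendre_proj :: "nat \<Rightarrow> (real \<Rightarrow> real) \<Rightarrow> real \<Rightarrow> real" where
  "legendre_proj n u c = (\<Sum>j<n. (2 * real j + 1) * shifted_legendre j c * legendre_coeff u j)"

lemma continuous_on_legendre_proj [continuous_intros]:
  "continuous_on S w \<Longrightarrow> continuous_on S (\<lambda>x. legendre_proj n u (w x))"
  unfolding legendre_proj_def by (intro continuous_intros)

lemma integrable_shifted_legendre_mult:
  "continuous_on {0..1} u \<Longrightarrow> (\<lambda>x. shifted_legendre j x * u x) integrable_on {0..1}"
  by (intro integrable_continuous_real continuous_intros)

lemma legendre_coeff_diff:
  assumes "continuous_on {0..1} u" "continuous_on {0..1} v"
  shows "legendre_coeff (\<lambda>x. u x - v x) j = legendre_coeff u j - legendre_coeff v j"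
  using integral_diff[OF integrable_shifted_legendre_mult[OF assms(1), of j]
      integrable_shifted_legendre_mult[OF assms(2), of j]]
  by (simp add: legendre_coeff_def right_diff_distrib)

lemma legendre_proj_diff:
  assumes "continuous_on {0..1} u" "continuous_on {0..1} v"
  shows "legendre_proj n (\<lambda>x. u x - v x) c = legendre_proj n u c - legendre_proj n v c"
  by (simp add: legendre_proj_def legendre_coeff_diff[OF assms] right_diff_distrib sum_subtractf)

lemma legendre_coeff_legendre_proj:
  assumes "j < n"
  shows "legendre_coeff (legendre_proj n u) j = legendre_coeff u j"
proof -
  have "legendre_coeff (legendre_proj n u) j = (\<Sum>i<n. integral {0..1}
      (\<lambda>x. ((2 * real i + 1) * legendre_coeff u i) * (shifted_legendre j x * shifted_legendre i x)))"
    unfolding legendre_coeff_def[of "legendre_proj n u"] legendre_proj_def sum_distrib_left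
    by (subst integral_sum) (auto intro!: integrable_continuous_real continuous_intros simp: mult_ac)
  also have "\<dots> = (\<Sum>i<n. if i = j then legendre_coeff u j else 0)"
  proof (intro sum.cong refl)
    fix i
    have "(2 * real j + 1) * legendre_coeff u j * (1 / (2 * real j + 1)) = legendre_coeff u j"
      by (simp add: field_simps)
    then show "integral {0..1} (\<lambda>x. ((2 * real i + 1) * legendre_coeff u i) *
        (shifted_legendre j x * shifted_legendre i x)) = (if i = j then legendre_coeff u j else 0)"
      unfolding integral_mult_right
      by (auto simp: integral_shifted_legendre_square shifted_legendre_orthogonal)
  qed
  also have "\<dots> = legendre_coeff u j" using assms by simp
  finally show ?thesis .
qed

text \<open>Subtracting a multiple of the Legendre polynomial of the same degree lowers the degree of \<open>p\<close>.\<close>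

lemma poly_eq_sum_shifted_legendre:
  "degree p < n \<Longrightarrow> \<exists>a. \<forall>x. poly p x = (\<Sum>j<n. a j * shifted_legendre j x)"
proof (induction n arbitrary: p)
  case (Suc n)
  define \<alpha> where "\<alpha> = coeff p n / coeff (legendre_poly n) n"
  define q where "q = p - smult \<alpha> (legendre_poly n)"
  have lc: "coeff (legendre_poly n) n \<noteq> 0" by (simp add: lead_coeff_legendre_poly)
  have p: "poly p x = poly q x + \<alpha> * shifted_legendre n x" for x
    by (simp add: q_def shifted_legendre_eq_poly)
  have dq: "degree q \<le> n"
    using Suc.prems by (auto simp: q_def degree_legendre_poly intro!: degree_diff_le)
  have q0: "coeff q n = 0" using lc by (simp add: q_def \<alpha>_def)
  show ?case
  proof (cases "n = 0")
    case True
    then have "q = 0" using dq q0 by (metis leading_coeff_0_iff le_zero_eq)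
    then show ?thesis using p True by (intro exI[of _ "\<lambda>_. \<alpha>"]) simp
  next
    case False
    have "degree q < n" using dq q0 False by (metis le_neq_implies_less leading_coeff_0_iff degree_0 neq0_conv)
    from Suc.IH[OF this] obtain a where a: "\<And>x. poly q x = (\<Sum>j<n. a j * shifted_legendre j x)" by blast
    show ?thesis
      by (intro exI[of _ "a(n := \<alpha>)"] allI) (simp add: p a)
  qed
qed simp

lemma legendre_residual_orthogonal:
  assumes u: "continuous_on {0..1} u" and p: "degree p < n"
  shows "integral {0..1} (\<lambda>x. poly p x * (u x - legendre_proj n u x)) = 0"
proof -
  obtain a where a: "\<And>x. poly p x = (\<Sum>j<n. a j * shifted_legendre j x)"
    using poly_eq_sum_shifted_legendre[OF p] by blast
  have "integral {0..1} (\<lambda>x. poly p x * (u x - legendre_proj n u x)) =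
     (\<Sum>j<n. integral {0..1} (\<lambda>x. a j * (shifted_legendre j x * (u x - legendre_proj n u x))))"
    unfolding a sum_distrib_right
    by (subst integral_sum) (auto intro!: integrable_continuous_real continuous_intros u simp: mult_ac)
  also have "\<dots> = (\<Sum>j<n. a j * legendre_coeff (\<lambda>x. u x - legendre_proj n u x) j)"
    by (simp add: legendre_coeff_def)
  also have "\<dots> = 0"
    by (intro sum.neutral)
      (auto simp: legendre_coeff_diff[OF u] legendre_coeff_legendre_proj continuous_on_legendre_proj)
  finally show ?thesis .
qed

lemma legendre_proj_orthogonal_residual:
  assumes u: "continuous_on {0..1} u"
  shows "integral {0..1} (\<lambda>x. legendre_proj n v x * (u x - legendre_proj n u x)) = 0"
proof (cases "n = 0")
  case False
  define p where "p = (\<Sum>j<n. smult ((2 * real j + 1) * legendre_coeff v j) (legendre_poly j))"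
  have "degree p < n" unfolding p_def
    using False by (intro degree_sum_less) (auto simp: degree_legendre_poly intro: le_less_trans[OF degree_smult_le])
  moreover have "poly p x = legendre_proj n v x" for x
    by (simp add: p_def legendre_proj_def poly_sum shifted_legendre_eq_poly mult_ac)
  ultimately show ?thesis using legendre_residual_orthogonal[OF u, of p n] by simp
qed (simp add: legendre_proj_def)

lemma legendre_proj_poly:
  assumes "degree p < n"
  shows "legendre_proj n (poly p) x = poly p x"
proof -
  obtain a where a: "\<And>x. poly p x = (\<Sum>j<n. a j * shifted_legendre j x)"
    using poly_eq_sum_shifted_legendre[OF assms] by blast
  have "legendre_coeff (poly p) j = a j / (2 * real j + 1)" if "j < n" for j
  proof -
    have "legendre_coeff (poly p) j =
        (\<Sum>i<n. integral {0..1} (\<lambda>x. a i * (shifted_legendre j x * shifted_legendre i x)))"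
      unfolding legendre_coeff_def a sum_distrib_left
      by (subst integral_sum) (auto intro!: integrable_continuous_real continuous_intros simp: mult_ac)
    also have "\<dots> = (\<Sum>i<n. if i = j then a j / (2 * real j + 1) else 0)"
      by (intro sum.cong refl)
        (auto simp: integral_shifted_legendre_square shifted_legendre_orthogonal)
    finally show ?thesis using that by simp
  qed
  then show ?thesis
    unfolding legendre_proj_def a[of x] by (intro sum.cong refl) simp
qed

section \<open>Pointwise sums of Legendre series\<close>

text \<open>Pythagoras: the truncated expansion and the residual are orthogonal.\<close>

lemma legendre_residual_square_le:
  assumes u: "continuous_on {0..1} u"
  shows "integral {0..1} (\<lambda>x. (u x - legendre_proj n u x)\<^sup>2) \<le> integral {0..1} (\<lambda>x. (u x)\<^sup>2)"
proof -
  let ?S = "legendre_proj n u"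
  have "integral {0..1} (\<lambda>x. (u x)\<^sup>2) =
      integral {0..1} (\<lambda>x. (u x - ?S x)\<^sup>2 + (?S x)\<^sup>2 + 2 * (?S x * (u x - ?S x)))"
    by (intro integral_cong) (simp add: power2_eq_square algebra_simps)
  also have "\<dots> = integral {0..1} (\<lambda>x. (u x - ?S x)\<^sup>2) + integral {0..1} (\<lambda>x. (?S x)\<^sup>2)
      + 2 * integral {0..1} (\<lambda>x. ?S x * (u x - ?S x))"
    by (subst integral_add integral_mult_right;
        (intro integrable_continuous_real continuous_intros u refl)?)+
  also have "integral {0..1} (\<lambda>x. ?S x * (u x - ?S x)) = 0"
    by (rule legendre_proj_orthogonal_residual[OF u])
  finally have "integral {0..1} (\<lambda>x. (u x)\<^sup>2) =
      integral {0..1} (\<lambda>x. (u x - ?S x)\<^sup>2) + integral {0..1} (\<lambda>x. (?S x)\<^sup>2)" by simp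
  moreover have "integral {0..1} (\<lambda>x. (?S x)\<^sup>2) \<ge> 0"
    by (intro integral_nonneg integrable_continuous_real continuous_intros) auto
  ultimately show ?thesis by simp
qed

text \<open>By the Weierstrass theorem \<open>g\<close> is uniformly close to a polynomial \<open>p\<close>. As soon as the expansion reaches the
degree of \<open>p\<close>, the residuals of \<open>g\<close> and of \<open>g - p\<close> coincide, and the latter is at most as large as
\<open>g - p\<close> in \<open>L\<^sup>2\<close>.\<close>

lemma legendre_residual_L2_tendsto_0:
  assumes g: "continuous_on {0..1} g"
  shows "(\<lambda>n. integral {0..1} (\<lambda>x. (g x - legendre_proj n g x)\<^sup>2)) \<longlonglongrightarrow> 0"
proof (rule LIMSEQ_I)
  fix \<epsilon> :: real assume "\<epsilon> > 0"
  then obtain q where q: "real_polynomial_function q" "\<And>x. x \<in> {0..1} \<Longrightarrow> \<bar>g x - q x\<bar> < sqrt (\<epsilon> / 2)"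
    using Stone_Weierstrass_real_polynomial_function[of "{0..1::real}" g "sqrt (\<epsilon> / 2)"] g by auto
  obtain a m where qa: "q = (\<lambda>x. \<Sum>i\<le>m. a i * x ^ i)"
    using q(1) real_polynomial_function_iff_sum by auto
  define p where "p = (\<Sum>i\<le>m. monom (a i) i)"
  have qp: "q = poly p" by (auto simp: qa p_def poly_sum poly_monom)
  have dp: "degree p \<le> m" unfolding p_def
    by (intro degree_sum_le) (auto intro: order_trans[OF degree_monom_le])
  have "norm (integral {0..1} (\<lambda>x. (g x - legendre_proj n g x)\<^sup>2) - 0) < \<epsilon>" if n: "n > m" for n
  proof -
    define u where "u = (\<lambda>x. g x - poly p x)"
    have u: "continuous_on {0..1} u" unfolding u_def by (intro continuous_intros g)
    have "g x - legendre_proj n g x = u x - legendre_proj n u x" for x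
      using legendre_proj_poly[of p n x] dp n
      by (simp add: u_def legendre_proj_diff g continuous_on_poly)
    then have "integral {0..1} (\<lambda>x. (g x - legendre_proj n g x)\<^sup>2) \<le> integral {0..1} (\<lambda>x. (u x)\<^sup>2)"
      using legendre_residual_square_le[OF u] by simp
    also have "\<dots> \<le> integral {0..1::real} (\<lambda>x. \<epsilon> / 2)"
    proof (intro integral_le integrable_continuous_real continuous_intros u)
      fix x :: real assume "x \<in> {0..1}"
      then have "\<bar>u x\<bar> \<le> sqrt (\<epsilon> / 2)" using q(2)[of x] by (simp add: u_def qp)
      then have "\<bar>u x\<bar>\<^sup>2 \<le> (sqrt (\<epsilon> / 2))\<^sup>2" by (intro power_mono) auto
      then show "(u x)\<^sup>2 \<le> \<epsilon> / 2" using \<open>\<epsilon> > 0\<close> by simp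
    qed
    also have "\<dots> < \<epsilon>" using \<open>\<epsilon> > 0\<close> by simp
    finally have "integral {0..1} (\<lambda>x. (g x - legendre_proj n g x)\<^sup>2) < \<epsilon>" .
    moreover have "integral {0..1} (\<lambda>x. (g x - legendre_proj n g x)\<^sup>2) \<ge> 0"
      by (intro integral_nonneg integrable_continuous_real continuous_intros g) auto
    ultimately show ?thesis by simp
  qed
  then show "\<exists>no. \<forall>n\<ge>no. norm (integral {0..1} (\<lambda>x. (g x - legendre_proj n g x)\<^sup>2) - 0) < \<epsilon>"
    by (intro exI[of _ "Suc m"]) auto
qed

text \<open>Fatou's lemma applied to the squared residuals: their pointwise limit has integral at most the limit of
their integrals, which is zero.\<close>

lemma pointwise_legendre_limit_eq_ae:
  assumes g: "continuous_on {0..1} g"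
    and lim: "\<And>c. c \<in> {0..1} \<Longrightarrow> (\<lambda>n. legendre_proj n g c) \<longlonglongrightarrow> d c"
  shows "negligible {c \<in> {0..1}. d c \<noteq> g c}"
proof -
  let ?s = "\<lambda>n x. (g x - legendre_proj n g x)\<^sup>2"
  let ?u = "\<lambda>n x. ennreal (?s n x) * indicator {0..1} x"
  let ?w = "\<lambda>x. ennreal ((g x - d x)\<^sup>2) * indicator {0..1} x"
  have meas: "?u n \<in> borel_measurable lebesgue" for n
  proof -
    have "(\<lambda>x. ?s n x * indicator {0..1} x) \<in> borel_measurable borel"
      using borel_measurable_continuous_on_indicator[of "{0..1::real}" "?s n"]
      by (simp add: mult.commute continuous_intros g)
    then have "(\<lambda>x. ennreal (?s n x * indicator {0..1} x)) \<in> borel_measurable lebesgue"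
      by (intro measurable_compose[OF _ measurable_ennreal]) (auto intro: measurable_completion)
    moreover have "?u n = (\<lambda>x. ennreal (?s n x * indicator {0..1} x))"
      by (auto simp: indicator_def)
    ultimately show ?thesis by simp
  qed
  have int_u: "(\<integral>\<^sup>+x. ?u n x \<partial>lebesgue) = ennreal (integral {0..1} (?s n))" for n
    unfolding nn_integral_completion
    by (intro nn_integral_has_integral_lebesgue' integrable_integral integrable_continuous_real
        continuous_intros g) auto
  have lim_u: "(\<lambda>n. ?u n x) \<longlonglongrightarrow> ?w x" for x
  proof (cases "x \<in> {0..1}")
    case True
    then show ?thesis by (auto intro!: tendsto_intros lim)
  qed simp
  have liminf_u: "liminf (\<lambda>n. ?u n x) = ?w x" for x
    using lim_imp_Liminf[OF _ lim_u] by simp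
  have "(\<integral>\<^sup>+x. ?w x \<partial>lebesgue) \<le> liminf (\<lambda>n. \<integral>\<^sup>+x. ?u n x \<partial>lebesgue)"
    using nn_integral_liminf[of ?u lebesgue, OF meas] by (simp add: liminf_u)
  also have "(\<lambda>n. \<integral>\<^sup>+x. ?u n x \<partial>lebesgue) \<longlonglongrightarrow> ennreal 0"
    unfolding int_u by (intro tendsto_ennrealI legendre_residual_L2_tendsto_0 g)
  then have "liminf (\<lambda>n. \<integral>\<^sup>+x. ?u n x \<partial>lebesgue) = 0"
    using lim_imp_Liminf[of sequentially "\<lambda>n. \<integral>\<^sup>+x. ?u n x \<partial>lebesgue" "ennreal 0"] by simp
  finally have "(\<integral>\<^sup>+x. ?w x \<partial>lebesgue) = 0" by simp
  moreover have "?w \<in> borel_measurable lebesgue"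
    by (rule borel_measurable_LIMSEQ_order[OF lim_u meas])
  ultimately have "AE x in lebesgue. ?w x = 0" by (simp add: nn_integral_0_iff_AE)
  then have "AE x in lebesgue. x \<notin> {c \<in> {0..1}. d c \<noteq> g c}"
    by eventually_elim (auto simp: indicator_def split: if_splits)
  then obtain N where N: "N \<in> null_sets lebesgue"
    "{x \<in> space lebesgue. \<not> x \<notin> {c \<in> {0..1}. d c \<noteq> g c}} \<subseteq> N"
    unfolding eventually_ae_filter by blast
  have "negligible N" using N(1) by (simp add: negligible_iff_null_sets)
  then show ?thesis by (rule negligible_subset) (use N(2) in auto)
qed

text \<open>
\<open>Y\<close> is the Henstock-Kurzweil integral of \<open>h * d\<close>, hence of \<open>h * g\<close>, which differs from it only on a null
set; the integral of the continuous function \<open>h * g\<close> can be differentiated everywhere. This recovers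
the original differential equation from its series form.\<close>

lemma has_derivative_of_pointwise_legendre_limit:
  assumes g: "continuous_on {0..1} g"
    and lim: "\<And>c. c \<in> {0..1} \<Longrightarrow> (\<lambda>n. legendre_proj n g c) \<longlonglongrightarrow> d c"
    and Y: "\<And>c. c \<in> {0..1} \<Longrightarrow> (Y has_real_derivative h * d c) (at c within {0..1})"
    and c: "c \<in> {0..1}"
  shows "(Y has_real_derivative h * g c) (at c within {0..1})"
proof -
  have Y_eq: "Y x = Y 0 + integral {0..x} (\<lambda>x. h * g x)" if x: "x \<in> {0..1}" for x
  proof -
    have "((\<lambda>x. h * d x) has_integral (Y x - Y 0)) {0..x}"
      using x by (intro fundamental_theorem_of_calculus)
        (auto simp: has_real_derivative_iff_has_vector_derivative[symmetric]
          intro!: DERIV_subset[OF Y])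
    then have "((\<lambda>x. h * g x) has_integral (Y x - Y 0)) {0..x}"
      using x by (rule_tac has_integral_spike[OF pointwise_legendre_limit_eq_ae[OF g lim]]) auto
    then show ?thesis by (simp add: integral_unique del: integral_mult_right)
  qed
  have "((\<lambda>x. Y 0 + integral {0..x} (\<lambda>x. h * g x)) has_real_derivative h * g c)
      (at c within {0..1})"
    unfolding has_real_derivative_iff_has_vector_derivative
    using c by (auto intro!: derivative_eq_intros integral_has_vector_derivative continuous_intros g)
  then show ?thesis
    by (rule has_field_derivative_transform_within[OF _ zero_less_one c]) (rule Y_eq[symmetric])
qed

section \<open>Families of functions that are smooth uniformly in the step size\<close>

text \<open>A family \<open>u h\<close> of functions of the rescaled time \<open>c \<in> [0,1]\<close>, where \<open>0 < h \<le> h0\<close>, with \<open>k\<close>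
derivatives with respect to the true time \<open>t0 + c * h\<close>, all continuous in \<open>c\<close> and
bounded uniformly in \<open>h\<close>. The factor
\<open>h\<close> in the derivative condition is that of the chain rule.\<close>

primrec smooth_family :: "real \<Rightarrow> nat \<Rightarrow> (real \<Rightarrow> real \<Rightarrow> real) \<Rightarrow> bool" where
  "smooth_family h0 0 u \<longleftrightarrow>
     (\<forall>h\<in>{0<..h0}. continuous_on {0..1} (u h)) \<and>
     (\<exists>C. \<forall>h\<in>{0<..h0}. \<forall>c\<in>{0..1}. \<bar>u h c\<bar> \<le> C)"
| "smooth_family h0 (Suc k) u \<longleftrightarrow>
     (\<exists>C. \<forall>h\<in>{0<..h0}. \<forall>c\<in>{0..1}. \<bar>u h c\<bar> \<le> C) \<and>
     (\<exists>v. smooth_family h0 k v \<and>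
        (\<forall>h\<in>{0<..h0}. \<forall>c\<in>{0..1}. (u h has_real_derivative h * v h c) (at c within {0..1})))"

lemma smooth_family_bounded:
  assumes "smooth_family h0 k u"
  obtains C where "C \<ge> 0" "\<And>h c. h \<in> {0<..h0} \<Longrightarrow> c \<in> {0..1} \<Longrightarrow> \<bar>u h c\<bar> \<le> C"
proof -
  have "\<exists>C. \<forall>h\<in>{0<..h0}. \<forall>c\<in>{0..1}. \<bar>u h c\<bar> \<le> C"
  proof (cases k)
    case 0
    show ?thesis using assms unfolding 0 smooth_family.simps(1) by (rule conjunct2)
  next
    case (Suc l)
    show ?thesis using assms unfolding Suc smooth_family.simps(2) by (rule conjunct1)
  qed
  then obtain C where C: "\<And>h c. h \<in> {0<..h0} \<Longrightarrow> c \<in> {0..1} \<Longrightarrow> \<bar>u h c\<bar> \<le> C" by blast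
  show ?thesis
  proof (rule that[of "max 0 C"])
    show "\<bar>u h c\<bar> \<le> max 0 C" if "h \<in> {0<..h0}" "c \<in> {0..1}" for h c
      using C[OF that] by linarith
  qed simp
qed

lemma smooth_family_continuous:
  assumes "smooth_family h0 k u" "h \<in> {0<..h0}"
  shows "continuous_on {0..1} (u h)"
proof (cases k)
  case 0
  then show ?thesis using assms by simp
next
  case (Suc l)
  then obtain v where "\<And>c. c \<in> {0..1} \<Longrightarrow> (u h has_real_derivative h * v h c) (at c within {0..1})"
    using assms unfolding Suc smooth_family.simps(2) by blast
  then show ?thesis by (rule DERIV_continuous_on)
qed

lemma smooth_family_SucI:
  assumes "\<And>h c. h \<in> {0<..h0} \<Longrightarrow> c \<in> {0..1} \<Longrightarrow> \<bar>u h c\<bar> \<le> C" "smooth_family h0 k v"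
    and "\<And>h c. h \<in> {0<..h0} \<Longrightarrow> c \<in> {0..1} \<Longrightarrow>
          (u h has_real_derivative h * v h c) (at c within {0..1})"
  shows "smooth_family h0 (Suc k) u"
  unfolding smooth_family.simps(2) using assms by (intro conjI exI[of _ C] exI[of _ v] ballI)

lemma smooth_family_SucE:
  assumes "smooth_family h0 (Suc k) u"
  obtains C v where "C \<ge> 0" "\<And>h c. h \<in> {0<..h0} \<Longrightarrow> c \<in> {0..1} \<Longrightarrow> \<bar>u h c\<bar> \<le> C"
    "smooth_family h0 k v"
    "\<And>h c. h \<in> {0<..h0} \<Longrightarrow> c \<in> {0..1} \<Longrightarrow>
          (u h has_real_derivative h * v h c) (at c within {0..1})"
proof -
  obtain C where C: "C \<ge> 0" "\<And>h c. h \<in> {0<..h0} \<Longrightarrow> c \<in> {0..1} \<Longrightarrow> \<bar>u h c\<bar> \<le> C"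
    by (rule smooth_family_bounded[OF assms]) (rule that)
  obtain v where v: "smooth_family h0 k v" "\<And>h c. h \<in> {0<..h0} \<Longrightarrow> c \<in> {0..1} \<Longrightarrow>
          (u h has_real_derivative h * v h c) (at c within {0..1})"
    using assms unfolding smooth_family.simps(2) by blast
  show ?thesis by (rule that[OF C v])
qed

lemma smooth_family_0I: "smooth_family h0 k u \<Longrightarrow> smooth_family h0 0 u"
  unfolding smooth_family.simps(1)
  by (auto elim: smooth_family_continuous) (rule smooth_family_bounded, assumption, force)

lemma smooth_family_Suc_imp: "smooth_family h0 (Suc k) u \<Longrightarrow> smooth_family h0 k u"
proof (induction k arbitrary: u)
  case 0
  then show ?case by (rule smooth_family_0I)
next
  case (Suc k)
  obtain C v where v: "C \<ge> 0" "\<And>h c. h \<in> {0<..h0} \<Longrightarrow> c \<in> {0..1} \<Longrightarrow> \<bar>u h c\<bar> \<le> C" "smooth_family h0 (Suc k) v"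
    "\<And>h c. h \<in> {0<..h0} \<Longrightarrow> c \<in> {0..1} \<Longrightarrow> (u h has_real_derivative h * v h c) (at c within {0..1})"
    by (rule smooth_family_SucE[OF Suc.prems]) (rule that)
  show ?case by (rule smooth_family_SucI[OF v(2) Suc.IH[OF v(3)] v(4)])
qed

lemma smooth_family_mono: "smooth_family h0 k u \<Longrightarrow> l \<le> k \<Longrightarrow> smooth_family h0 l u"
proof (induction k)
  case (Suc k)
  then show ?case
    by (cases "l = Suc k") (use smooth_family_Suc_imp in \<open>simp_all del: smooth_family.simps(2)\<close>)
qed simp

lemma smooth_family_add:
  "smooth_family h0 k u \<Longrightarrow> smooth_family h0 k v \<Longrightarrow> smooth_family h0 k (\<lambda>h c. u h c + v h c)"
proof (induction k arbitrary: u v)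
  case 0
  obtain C where C: "C \<ge> 0" "\<And>h c. h \<in> {0<..h0} \<Longrightarrow> c \<in> {0..1} \<Longrightarrow> \<bar>u h c\<bar> \<le> C"
    by (rule smooth_family_bounded[OF 0(1)]) (rule that)
  obtain D where D: "D \<ge> 0" "\<And>h c. h \<in> {0<..h0} \<Longrightarrow> c \<in> {0..1} \<Longrightarrow> \<bar>v h c\<bar> \<le> D"
    by (rule smooth_family_bounded[OF 0(2)]) (rule that)
  show ?case unfolding smooth_family.simps(1)
  proof (intro conjI ballI exI)
    show "\<bar>u h c + v h c\<bar> \<le> C + D" if "h \<in> {0<..h0}" "c \<in> {0..1}" for h c
      using C(2)[OF that] D(2)[OF that] by linarith
  qed (intro continuous_intros smooth_family_continuous[OF 0(1)] smooth_family_continuous[OF 0(2)])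
next
  case (Suc k)
  obtain C u' where u: "C \<ge> 0" "\<And>h c. h \<in> {0<..h0} \<Longrightarrow> c \<in> {0..1} \<Longrightarrow> \<bar>u h c\<bar> \<le> C"
     "smooth_family h0 k u'"
    "\<And>h c. h \<in> {0<..h0} \<Longrightarrow> c \<in> {0..1} \<Longrightarrow> (u h has_real_derivative h * u' h c) (at c within {0..1})"
    by (rule smooth_family_SucE[OF Suc.prems(1)]) (rule that)
  obtain D v' where v: "D \<ge> 0" "\<And>h c. h \<in> {0<..h0} \<Longrightarrow> c \<in> {0..1} \<Longrightarrow> \<bar>v h c\<bar> \<le> D"
     "smooth_family h0 k v'"
    "\<And>h c. h \<in> {0<..h0} \<Longrightarrow> c \<in> {0..1} \<Longrightarrow> (v h has_real_derivative h * v' h c) (at c within {0..1})"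
    by (rule smooth_family_SucE[OF Suc.prems(2)]) (rule that)
  show ?case
  proof (rule smooth_family_SucI[OF _ Suc.IH[OF u(3) v(3)]])
    fix h c :: real assume hc: "h \<in> {0<..h0}" "c \<in> {0..1}"
    show "\<bar>u h c + v h c\<bar> \<le> C + D" using u(2)[OF hc] v(2)[OF hc] by linarith
    show "((\<lambda>c. u h c + v h c) has_real_derivative h * (u' h c + v' h c)) (at c within {0..1})"
      using DERIV_add[OF u(4)[OF hc] v(4)[OF hc]] by (simp add: algebra_simps)
  qed
qed

lemma smooth_family_mult:
  "smooth_family h0 k u \<Longrightarrow> smooth_family h0 k v \<Longrightarrow> smooth_family h0 k (\<lambda>h c. u h c * v h c)"
proof (induction k arbitrary: u v)
  case 0
  obtain C where C: "C \<ge> 0" "\<And>h c. h \<in> {0<..h0} \<Longrightarrow> c \<in> {0..1} \<Longrightarrow> \<bar>u h c\<bar> \<le> C"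
    by (rule smooth_family_bounded[OF 0(1)]) (rule that)
  obtain D where D: "D \<ge> 0" "\<And>h c. h \<in> {0<..h0} \<Longrightarrow> c \<in> {0..1} \<Longrightarrow> \<bar>v h c\<bar> \<le> D"
    by (rule smooth_family_bounded[OF 0(2)]) (rule that)
  show ?case unfolding smooth_family.simps(1)
  proof (intro conjI ballI exI)
    show "\<bar>u h c * v h c\<bar> \<le> C * D" if "h \<in> {0<..h0}" "c \<in> {0..1}" for h c
      unfolding abs_mult using C(2)[OF that] D(2)[OF that] C(1) D(1) by (intro mult_mono) auto
  qed (intro continuous_intros smooth_family_continuous[OF 0(1)] smooth_family_continuous[OF 0(2)])
next
  case (Suc k)
  obtain C u' where u: "C \<ge> 0" "\<And>h c. h \<in> {0<..h0} \<Longrightarrow> c \<in> {0..1} \<Longrightarrow> \<bar>u h c\<bar> \<le> C"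
     "smooth_family h0 k u'"
    "\<And>h c. h \<in> {0<..h0} \<Longrightarrow> c \<in> {0..1} \<Longrightarrow> (u h has_real_derivative h * u' h c) (at c within {0..1})"
    by (rule smooth_family_SucE[OF Suc.prems(1)]) (rule that)
  obtain D v' where v: "D \<ge> 0" "\<And>h c. h \<in> {0<..h0} \<Longrightarrow> c \<in> {0..1} \<Longrightarrow> \<bar>v h c\<bar> \<le> D"
     "smooth_family h0 k v'"
    "\<And>h c. h \<in> {0<..h0} \<Longrightarrow> c \<in> {0..1} \<Longrightarrow> (v h has_real_derivative h * v' h c) (at c within {0..1})"
    by (rule smooth_family_SucE[OF Suc.prems(2)]) (rule that)
  have deriv: "smooth_family h0 k (\<lambda>h c. u h c * v' h c + u' h c * v h c)"
    using Suc.prems[THEN smooth_family_Suc_imp] u(3) v(3)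
    by (intro smooth_family_add Suc.IH)
  show ?case
  proof (rule smooth_family_SucI[OF _ deriv])
    fix h c :: real assume hc: "h \<in> {0<..h0}" "c \<in> {0..1}"
    show "\<bar>u h c * v h c\<bar> \<le> C * D"
      unfolding abs_mult using u(2)[OF hc] v(2)[OF hc] u(1) v(1) by (intro mult_mono) auto
    show "((\<lambda>c. u h c * v h c) has_real_derivative h * (u h c * v' h c + u' h c * v h c))
        (at c within {0..1})"
      using DERIV_mult[OF u(4)[OF hc] v(4)[OF hc]] by (simp add: algebra_simps)
  qed
qed

text \<open>Each derivative of \<open>c ^ i\<close> with respect to true time costs a factor \<open>1 / h\<close>, and there are only \<open>i\<close> nonzero
ones; so the coefficient has to compensate for \<open>min i k\<close> of them.\<close>

lemma smooth_family_monomial: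
  assumes "\<And>h. h \<in> {0<..h0} \<Longrightarrow> \<bar>\<gamma> h\<bar> \<le> C * h ^ min i k"
  shows "smooth_family h0 k (\<lambda>h c. \<gamma> h * c ^ i)"
  using assms
proof (induction k arbitrary: i \<gamma> C)
  case 0
  show ?case unfolding smooth_family.simps(1)
  proof (intro conjI ballI exI continuous_intros)
    fix h c :: real assume "h \<in> {0<..h0}" "c \<in> {0..1}"
    then have "\<bar>\<gamma> h\<bar> * \<bar>c ^ i\<bar> \<le> C * 1"
      using 0[of h] by (intro mult_mono) (auto simp: power_le_one intro: order_trans[OF abs_ge_zero])
    then show "\<bar>\<gamma> h * c ^ i\<bar> \<le> C" by (simp add: abs_mult)
  qed
next
  case (Suc k)
  have bd: "\<bar>\<gamma> h * c ^ i\<bar> \<le> \<bar>C\<bar> * h0 ^ min i (Suc k)" if "h \<in> {0<..h0}" "c \<in> {0..1}" for h c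
  proof -
    have "\<bar>\<gamma> h\<bar> * \<bar>c ^ i\<bar> \<le> \<bar>\<gamma> h\<bar> * 1"
      using that by (intro mult_left_mono) (auto simp: power_le_one)
    also have "\<bar>\<gamma> h\<bar> \<le> \<bar>C\<bar> * h ^ min i (Suc k)"
      using Suc.prems[OF that(1)] that by (auto intro: order_trans mult_right_mono)
    also have "\<dots> \<le> \<bar>C\<bar> * h0 ^ min i (Suc k)"
      using that by (intro mult_left_mono power_mono) auto
    finally show ?thesis by (simp add: abs_mult)
  qed
  have "\<bar>\<gamma> h * real i / h\<bar> \<le> real i * C * h ^ min (i - 1) k" if h: "h \<in> {0<..h0}" for h
  proof (cases i)
    case (Suc j)
    have "\<bar>\<gamma> h\<bar> / h \<le> C * h ^ min i (Suc k) / h"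
      using h Suc.prems[OF h] by (intro divide_right_mono) auto
    also have "\<dots> = C * h ^ min (i - 1) k" using h Suc by simp
    finally have "real i * (\<bar>\<gamma> h\<bar> / h) \<le> real i * (C * h ^ min (i - 1) k)"
      by (intro mult_left_mono) auto
    then show ?thesis using h by (simp add: abs_mult mult_ac)
  qed simp
  from Suc.IH[OF this] have deriv: "smooth_family h0 k (\<lambda>h c. \<gamma> h * real i / h * c ^ (i - 1))" .
  show ?case
  proof (rule smooth_family_SucI[OF _ deriv])
    show "h \<in> {0<..h0} \<Longrightarrow> c \<in> {0..1} \<Longrightarrow> \<bar>\<gamma> h * c ^ i\<bar> \<le> \<bar>C\<bar> * h0 ^ min i (Suc k)" for h c
      by (rule bd)
  next
    fix h c :: real assume "h \<in> {0<..h0}"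
    then have "h * (\<gamma> h * real i / h * c ^ (i - 1)) = \<gamma> h * (real i * c ^ (i - 1))" by simp
    moreover have "((\<lambda>c. \<gamma> h * c ^ i) has_real_derivative \<gamma> h * (real i * c ^ (i - 1)))
        (at c within {0..1})"
      using DERIV_subset[OF DERIV_pow[of i c]] by (intro DERIV_cmult) auto
    ultimately show "((\<lambda>c. \<gamma> h * c ^ i) has_real_derivative h * (\<gamma> h * real i / h * c ^ (i - 1)))
        (at c within {0..1})"
      by simp
  qed
qed

lemma smooth_family_const: "smooth_family h0 k (\<lambda>h c. a)"
  using smooth_family_monomial[of h0 "\<lambda>_. a" "\<bar>a\<bar>" 0 k] by simp

lemma smooth_family_sum:
  "(\<And>i. i \<in> I \<Longrightarrow> smooth_family h0 k (u i)) \<Longrightarrow> smooth_family h0 k (\<lambda>h c. \<Sum>i\<in>I. u i h c)"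
  by (induction I rule: infinite_finite_induct)
    (auto simp del: smooth_family.simps intro!: smooth_family_add smooth_family_const[of _ _ 0])

text \<open>Taylor's theorem. The approximating polynomial of \<open>u h\<close> is the integral of the one for its derivative,
and the derivative bound of the difference gains the factor \<open>h\<close>.\<close>

lemma smooth_family_taylor:
  "smooth_family h0 k u \<Longrightarrow> \<exists>C\<ge>0. \<forall>h\<in>{0<..h0}. \<exists>a. \<forall>c\<in>{0..1}. \<bar>u h c - (\<Sum>i<k. a i * c ^ i)\<bar> \<le> C * h ^ k"
proof (induction k arbitrary: u)
  case 0
  obtain C where "C \<ge> 0" "\<And>h c. h \<in> {0<..h0} \<Longrightarrow> c \<in> {0..1} \<Longrightarrow> \<bar>u h c\<bar> \<le> C"
    by (rule smooth_family_bounded[OF 0]) (rule that)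
  then show ?case by (intro exI[of _ C]) simp
next
  case (Suc k)
  obtain C0 v where "C0 \<ge> 0" "\<And>h c. h \<in> {0<..h0} \<Longrightarrow> c \<in> {0..1} \<Longrightarrow> \<bar>u h c\<bar> \<le> C0"
    and v: "smooth_family h0 k v"
    "\<And>h c. h \<in> {0<..h0} \<Longrightarrow> c \<in> {0..1} \<Longrightarrow> (u h has_real_derivative h * v h c) (at c within {0..1})"
    by (rule smooth_family_SucE[OF Suc.prems]) (rule that)
  obtain C where C: "C \<ge> 0" "\<forall>h\<in>{0<..h0}. \<exists>a. \<forall>c\<in>{0..1}. \<bar>v h c - (\<Sum>i<k. a i * c ^ i)\<bar> \<le> C * h ^ k"
    using Suc.IH[OF v(1)] by blast
  have "\<exists>b. \<forall>c\<in>{0..1}. \<bar>u h c - (\<Sum>i<Suc k. b i * c ^ i)\<bar> \<le> C * h ^ Suc k" if h: "h \<in> {0<..h0}" for h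
  proof -
    obtain a where a: "\<And>c. c \<in> {0..1} \<Longrightarrow> \<bar>v h c - (\<Sum>i<k. a i * c ^ i)\<bar> \<le> C * h ^ k"
      using C h by blast
    define b where "b i = (case i of 0 \<Rightarrow> u h 0 | Suc j \<Rightarrow> h * a j / real (Suc j))" for i
    \<comment> \<open>\<open>b\<close> lists the coefficients of \<open>u h 0\<close> plus \<open>h\<close> times the antiderivative of the Taylor polynomial of \<open>v h\<close>.\<close>
    define w where "w c = u h c - (\<Sum>i<Suc k. b i * c ^ i)" for c
    have w': "(w has_real_derivative h * (v h c - (\<Sum>i<k. a i * c ^ i))) (at c within {0..1})"
      if "c \<in> {0..1}" for c
      unfolding w_def sum.lessThan_Suc_shift
    proof -
      have mono: "((\<lambda>c. b (Suc i) * c ^ Suc i) has_real_derivative h * (a i * c ^ i)) (at c within {0..1})" for i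
      proof -
        have "((\<lambda>c. b (Suc i) * c ^ Suc i) has_real_derivative b (Suc i) * (real (Suc i) * c ^ i))
            (at c within {0..1})"
          using DERIV_subset[OF DERIV_pow[of "Suc i" c]] by (intro DERIV_cmult) auto
        then show ?thesis by (simp add: b_def del: power_Suc)
      qed
      have "((\<lambda>c. \<Sum>i<k. b (Suc i) * c ^ Suc i) has_real_derivative (\<Sum>i<k. h * (a i * c ^ i)))
          (at c within {0..1})"
        by (intro DERIV_sum mono)
      from DERIV_diff[OF v(2)[OF h that] DERIV_add[OF DERIV_const[of "b 0 * c ^ 0"] this]]
      show "((\<lambda>c. u h c - (b 0 * c ^ 0 + (\<Sum>i<k. b (Suc i) * c ^ Suc i))) has_real_derivative
          h * (v h c - (\<Sum>i<k. a i * c ^ i))) (at c within {0..1})"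
        by (simp add: right_diff_distrib sum_distrib_left)
    qed
    have "\<bar>w c\<bar> \<le> C * h ^ Suc k" if c: "c \<in> {0..1}" for c
    proof -
      have "norm (w c - w 0) \<le> (C * h ^ Suc k) * norm (c - 0)"
      proof (rule field_differentiable_bound[of "{0..1}" w "\<lambda>c. h * (v h c - (\<Sum>i<k. a i * c ^ i))"])
        fix x :: real assume x: "x \<in> {0..1}"
        then show "(w has_field_derivative h * (v h x - (\<Sum>i<k. a i * x ^ i))) (at x within {0..1})"
          by (rule w')
        have "h * \<bar>v h x - (\<Sum>i<k. a i * x ^ i)\<bar> \<le> h * (C * h ^ k)"
          using h a[OF x] by (intro mult_left_mono) auto
        then show "norm (h * (v h x - (\<Sum>i<k. a i * x ^ i))) \<le> C * h ^ Suc k"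
          using h by (simp add: abs_mult mult_ac)
      qed (use c in auto)
      also have "\<dots> \<le> C * h ^ Suc k * 1" using c h C(1) by (intro mult_left_mono) auto
      moreover have "w 0 = 0" unfolding w_def sum.lessThan_Suc_shift by (simp add: b_def)
      ultimately show ?thesis by simp
    qed
    then show ?thesis unfolding w_def by blast
  qed
  then show ?case using C(1) by blast
qed

section \<open>Decay of Legendre coefficients\<close>

lemma abs_integral_mult_le:
  fixes u w :: "real \<Rightarrow> real"
  assumes "continuous_on {0..1} u" "continuous_on {0..1} w"
    and "\<And>c. c \<in> {0..1} \<Longrightarrow> \<bar>u c\<bar> \<le> A" "\<And>c. c \<in> {0..1} \<Longrightarrow> \<bar>w c\<bar> \<le> B"
  shows "\<bar>integral {0..1} (\<lambda>c. u c * w c)\<bar> \<le> A * B"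
proof -
  have "norm (integral {0..1} (\<lambda>c. u c * w c)) \<le> A * B * (1 - 0)"
  proof (rule integral_bound)
    fix c :: real assume c: "c \<in> {0..1}"
    have "0 \<le> A" using assms(3)[OF c] by linarith
    then show "norm (u c * w c) \<le> A * B"
      using assms(3,4)[OF c] by (auto simp: abs_mult intro!: mult_mono)
  qed (auto intro!: continuous_intros assms)
  then show ?thesis by simp
qed

text \<open>Only the Taylor remainder of \<open>u\<close> contributes to the integral. The constant depends neither on \<open>w\<close> nor on
\<open>h\<close>, so \<open>w\<close> may itself vary with \<open>h\<close>.\<close>

lemma smooth_family_orthogonal_bound:
  assumes "smooth_family h0 k u"
  shows "\<exists>C\<ge>0. \<forall>h\<in>{0<..h0}. \<forall>w M. continuous_on {0..1} w \<longrightarrow>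
    (\<forall>c\<in>{0..1}. \<bar>w c\<bar> \<le> M) \<longrightarrow> (\<forall>a. integral {0..1} (\<lambda>c. (\<Sum>i<k. a i * c ^ i) * w c) = 0) \<longrightarrow>
    \<bar>integral {0..1} (\<lambda>c. u h c * w c)\<bar> \<le> C * h ^ k * M"
proof -
  obtain C where C: "C \<ge> 0"
    "\<forall>h\<in>{0<..h0}. \<exists>a. \<forall>c\<in>{0..1}. \<bar>u h c - (\<Sum>i<k. a i * c ^ i)\<bar> \<le> C * h ^ k"
    using smooth_family_taylor[OF assms] by blast
  have "\<bar>integral {0..1} (\<lambda>c. u h c * w c)\<bar> \<le> C * h ^ k * M"
    if h: "h \<in> {0<..h0}" and w: "continuous_on {0..1} w" "\<And>c. c \<in> {0..1} \<Longrightarrow> \<bar>w c\<bar> \<le> M"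
      and orth: "\<And>a. integral {0..1} (\<lambda>c. (\<Sum>i<k. a i * c ^ i) * w c) = 0" for h w M
  proof -
    obtain a where a: "\<And>c. c \<in> {0..1} \<Longrightarrow> \<bar>u h c - (\<Sum>i<k. a i * c ^ i)\<bar> \<le> C * h ^ k"
      using C(2) h by blast
    have u: "continuous_on {0..1} (u h)" by (rule smooth_family_continuous[OF assms h])
    have "integral {0..1} (\<lambda>c. (u h c - (\<Sum>i<k. a i * c ^ i)) * w c) =
        integral {0..1} (\<lambda>c. u h c * w c) - integral {0..1} (\<lambda>c. (\<Sum>i<k. a i * c ^ i) * w c)"
      unfolding left_diff_distrib
      by (intro integral_diff integrable_continuous_real continuous_intros u w)
    then have "integral {0..1} (\<lambda>c. u h c * w c) =
        integral {0..1} (\<lambda>c. (u h c - (\<Sum>i<k. a i * c ^ i)) * w c)"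
      by (simp add: orth)
    moreover have "continuous_on {0..1} (\<lambda>c. u h c - (\<Sum>i<k. a i * c ^ i))"
      by (intro continuous_intros u)
    ultimately show ?thesis
      using abs_integral_mult_le[of "\<lambda>c. u h c - (\<Sum>i<k. a i * c ^ i)" w "C * h ^ k" M] a w
      by simp
  qed
  then show ?thesis using C(1) by (intro exI[of _ C]) blast
qed

lemma power_sum_eq_poly:
  fixes a :: "nat \<Rightarrow> real"
  assumes "k > 0"
  obtains p where "degree p < k" "poly p = (\<lambda>c. \<Sum>i<k. a i * c ^ i)"
proof
  show "degree (\<Sum>i<k. monom (a i) i) < k"
    using assms by (intro degree_sum_less) (auto intro: le_less_trans[OF degree_monom_le])
  show "poly (\<Sum>i<k. monom (a i) i) = (\<lambda>c. \<Sum>i<k. a i * c ^ i)"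
    by (auto simp: poly_sum poly_monom)
qed

lemma shifted_legendre_orthogonal_power_sum:
  assumes "k \<le> j"
  shows "integral {0..1} (\<lambda>c. (\<Sum>i<k. a i * c ^ i) * shifted_legendre j c) = 0"
proof (cases "k = 0")
  case False
  then obtain p where p: "degree p < k" "poly p = (\<lambda>c. \<Sum>i<k. a i * c ^ i)"
    using power_sum_eq_poly[of k a] by blast
  then show ?thesis
    using shifted_legendre_orthogonal_poly[of p j] assms by (simp add: mult.commute)
qed simp

lemma legendre_residual_orthogonal_power_sum:
  assumes "continuous_on {0..1} u"
  shows "integral {0..1} (\<lambda>c. (\<Sum>i<n. a i * c ^ i) * (u c - legendre_proj n u c)) = 0"
proof (cases "n = 0")
  case False
  then obtain p where p: "degree p < n" "poly p = (\<lambda>c. \<Sum>i<n. a i * c ^ i)"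
    using power_sum_eq_poly[of n a] by blast
  then show ?thesis using legendre_residual_orthogonal[OF assms, of p n] by simp
qed simp

lemma shifted_legendre_bounded:
  obtains B where "B \<ge> 0" "\<And>c. c \<in> {0..1} \<Longrightarrow> \<bar>shifted_legendre j c\<bar> \<le> B"
proof -
  have "compact (shifted_legendre j ` {0..1})"
    by (intro compact_continuous_image continuous_intros compact_Icc)
  then have "bounded (shifted_legendre j ` {0..1})" by (rule compact_imp_bounded)
  then obtain B where "\<forall>c\<in>{0..1}. \<bar>shifted_legendre j c\<bar> \<le> B"
    unfolding bounded_iff by auto
  then show ?thesis using that[of "max B 0"] by (meson max.cobounded1 max.cobounded2 order_trans)
qed

lemma smooth_family_legendre_coeff_bound:
  assumes "smooth_family h0 k u"
  shows "\<exists>C\<ge>0. \<forall>h\<in>{0<..h0}. \<bar>legendre_coeff (u h) j\<bar> \<le> C * h ^ min j k"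
proof -
  have "smooth_family h0 (min j k) u" using assms by (rule smooth_family_mono) simp
  from smooth_family_orthogonal_bound[OF this] obtain C where C: "C \<ge> 0"
    "\<forall>h\<in>{0<..h0}. \<forall>w M. continuous_on {0..1} w \<longrightarrow>
      (\<forall>c\<in>{0..1}. \<bar>w c\<bar> \<le> M) \<longrightarrow> (\<forall>a. integral {0..1} (\<lambda>c. (\<Sum>i<min j k. a i * c ^ i) * w c) = 0) \<longrightarrow>
      \<bar>integral {0..1} (\<lambda>c. u h c * w c)\<bar> \<le> C * h ^ min j k * M" by (elim exE conjE)
  obtain B where B: "B \<ge> 0" "\<And>c. c \<in> {0..1} \<Longrightarrow> \<bar>shifted_legendre j c\<bar> \<le> B"
    using shifted_legendre_bounded[of j] by blast
  have "\<bar>legendre_coeff (u h) j\<bar> \<le> (C * B) * h ^ min j k" if "h \<in> {0<..h0}" for h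
    using C(2)[rule_format, OF that _ B(2) shifted_legendre_orthogonal_power_sum[of "min j k" j],
        OF continuous_on_shifted_legendre[OF continuous_on_id]]
    by (simp add: legendre_coeff_def mult_ac)
  then show ?thesis using C(1) B(1) by (intro exI[of _ "C * B"]) auto
qed

text \<open>By the decay of the coefficients, the \<open>j\<close>-th term is \<open>O(h ^ min j k)\<close> times a polynomial of degree \<open>j\<close>,
which is just small enough for the derivatives of that polynomial in true time to stay bounded.\<close>

lemma smooth_family_legendre_proj:
  assumes "smooth_family h0 k u"
  shows "smooth_family h0 k (\<lambda>h. legendre_proj n (u h))"
proof -
  have "smooth_family h0 k (\<lambda>h c. (2 * real j + 1) * coeff (legendre_poly j) i * legendre_coeff (u h) j * c ^ i)"
    if "i \<le> j" for i j
  proof -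
    let ?K = "(2 * real j + 1) * coeff (legendre_poly j) i"
    obtain C where C: "C \<ge> 0" "\<And>h. h \<in> {0<..h0} \<Longrightarrow> \<bar>legendre_coeff (u h) j\<bar> \<le> C * h ^ min j k"
      using smooth_family_legendre_coeff_bound[OF assms, of j] by blast
    show ?thesis
    proof (rule smooth_family_monomial)
      fix h assume h: "h \<in> {0<..h0}"
      \<comment> \<open>The coefficient is \<open>O(h ^ min j k)\<close>; surplus powers of \<open>h\<close> are at most powers of \<open>1 + h0\<close>.\<close>
      have "h ^ min j k = h ^ min i k * h ^ (min j k - min i k)"
        using that by (simp flip: power_add)
      also have "\<dots> \<le> h ^ min i k * (1 + h0) ^ (min j k - min i k)"
        using h by (intro mult_left_mono power_mono) auto
      also have "\<dots> \<le> h ^ min i k * (1 + h0) ^ j"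
        using h by (intro mult_left_mono power_increasing) auto
      finally have "\<bar>legendre_coeff (u h) j\<bar> \<le> C * (h ^ min i k * (1 + h0) ^ j)"
        using C(1) by (intro order_trans[OF C(2)[OF h]] mult_left_mono)
      then have "\<bar>?K\<bar> * \<bar>legendre_coeff (u h) j\<bar> \<le> \<bar>?K\<bar> * (C * (h ^ min i k * (1 + h0) ^ j))"
        by (intro mult_left_mono) auto
      then show "\<bar>?K * legendre_coeff (u h) j\<bar> \<le> (\<bar>?K\<bar> * C * (1 + h0) ^ j) * h ^ min i k"
        by (simp add: abs_mult mult_ac)
    qed
  qed
  then have "smooth_family h0 k (\<lambda>h c. \<Sum>j<n. \<Sum>i\<le>j.
      (2 * real j + 1) * coeff (legendre_poly j) i * legendre_coeff (u h) j * c ^ i)"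
    by (intro smooth_family_sum) auto
  moreover have "legendre_proj n (u h) c = (\<Sum>j<n. \<Sum>i\<le>j.
      (2 * real j + 1) * coeff (legendre_poly j) i * legendre_coeff (u h) j * c ^ i)" for h c
    unfolding legendre_proj_def shifted_legendre_eq_poly poly_altdef degree_legendre_poly
    by (simp add: sum_distrib_left sum_distrib_right mult_ac)
  ultimately show ?thesis by presburger
qed

text \<open>The projection reproduces the Taylor polynomial, so the residual is that of the Taylor remainder, and the
projection is bounded in the supremum norm.\<close>

lemma smooth_family_legendre_residual_bound:
  assumes u: "smooth_family h0 n u"
  shows "\<exists>C\<ge>0. \<forall>h\<in>{0<..h0}. \<forall>c\<in>{0..1}. \<bar>u h c - legendre_proj n (u h) c\<bar> \<le> C * h ^ n"
proof -
  obtain C where C: "C \<ge> 0"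
    "\<forall>h\<in>{0<..h0}. \<exists>a. \<forall>c\<in>{0..1}. \<bar>u h c - (\<Sum>i<n. a i * c ^ i)\<bar> \<le> C * h ^ n"
    using smooth_family_taylor[OF u] by blast
  have "\<exists>B\<ge>0. \<forall>c\<in>{0..1}. \<bar>shifted_legendre j c\<bar> \<le> B" for j
    using shifted_legendre_bounded by metis
  then obtain B where B: "\<And>j. B j \<ge> 0" "\<And>j c. c \<in> {0..1} \<Longrightarrow> \<bar>shifted_legendre j c\<bar> \<le> B j"
    by metis
  define K where "K = (1 + (\<Sum>j<n. (2 * real j + 1) * B j * B j)) * C"
  have "\<bar>u h c - legendre_proj n (u h) c\<bar> \<le> K * h ^ n" if h: "h \<in> {0<..h0}" and c: "c \<in> {0..1}" for h c
  proof -
    obtain a where a: "\<And>c. c \<in> {0..1} \<Longrightarrow> \<bar>u h c - (\<Sum>i<n. a i * c ^ i)\<bar> \<le> C * h ^ n"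
      using C(2) h by blast
    define w where "w c = u h c - (\<Sum>i<n. a i * c ^ i)" for c
    have cu: "continuous_on {0..1} (u h)" by (rule smooth_family_continuous[OF u h])
    then have cw: "continuous_on {0..1} w" unfolding w_def by (intro continuous_intros)
    have "legendre_proj n (\<lambda>c. \<Sum>i<n. a i * c ^ i) c = (\<Sum>i<n. a i * c ^ i)"
    proof (cases "n = 0")
      case False
      then obtain p where p: "degree p < n" "poly p = (\<lambda>c. \<Sum>i<n. a i * c ^ i)"
        using power_sum_eq_poly[of n a] by blast
      then show ?thesis using legendre_proj_poly[OF p(1), of c] by simp
    qed (simp add: legendre_proj_def)
    then have eq: "u h c - legendre_proj n (u h) c = w c - legendre_proj n w c"
      unfolding w_def by (subst legendre_proj_diff) (auto intro!: continuous_intros cu)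
    have "\<bar>legendre_proj n w c\<bar> \<le> (\<Sum>j<n. (2 * real j + 1) * B j * (B j * (C * h ^ n)))"
      unfolding legendre_proj_def
    proof (intro order_trans[OF sum_abs] sum_mono)
      fix j
      have "\<bar>legendre_coeff w j\<bar> \<le> B j * (C * h ^ n)"
        unfolding legendre_coeff_def using a B(2) cw
        by (intro abs_integral_mult_le) (auto intro!: continuous_intros simp: w_def)
      then show "\<bar>(2 * real j + 1) * shifted_legendre j c * legendre_coeff w j\<bar>
          \<le> (2 * real j + 1) * B j * (B j * (C * h ^ n))"
        unfolding abs_mult using B c by (intro mult_mono) auto
    qed
    also have "\<dots> = (\<Sum>j<n. (2 * real j + 1) * B j * B j) * (C * h ^ n)"
      by (simp only: sum_distrib_right mult.assoc)
    finally have "\<bar>legendre_proj n w c\<bar> \<le> (\<Sum>j<n. (2 * real j + 1) * B j * B j) * (C * h ^ n)" .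
    moreover have "\<bar>w c\<bar> \<le> C * h ^ n" using a[OF c] by (simp add: w_def)
    ultimately have "\<bar>w c - legendre_proj n w c\<bar> \<le> C * h ^ n + (\<Sum>j<n. (2 * real j + 1) * B j * B j) * (C * h ^ n)"
      using abs_triangle_ineq4[of "w c" "legendre_proj n w c"] by linarith
    also have "\<dots> = K * h ^ n" unfolding K_def by (simp only: distrib_right mult_1 mult.assoc)
    finally show ?thesis unfolding eq .
  qed
  moreover have "K \<ge> 0" unfolding K_def using C(1) B(1) by (intro mult_nonneg_nonneg add_nonneg_nonneg sum_nonneg) auto
  ultimately show ?thesis by blast
qed

section \<open>Composition with differentiable maps and bootstrapping\<close>

lemma has_vector_derivative_of_components:
  fixes X :: "real \<Rightarrow> 'a::euclidean_space"
  assumes "\<And>b. b \<in> Basis \<Longrightarrow> ((\<lambda>c. X c \<bullet> b) has_real_derivative D b) (at c within S)"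
  shows "(X has_vector_derivative (\<Sum>b\<in>Basis. D b *\<^sub>R b)) (at c within S)"
proof -
  have "((\<lambda>c. \<Sum>b\<in>Basis. (X c \<bullet> b) *\<^sub>R b) has_vector_derivative (\<Sum>b\<in>Basis. D b *\<^sub>R b)) (at c within S)"
    using assms by (intro has_vector_derivative_sum) (auto intro!: derivative_eq_intros)
  then show ?thesis by (simp add: euclidean_representation)
qed

lemma C_k_continuous: "C_k k F \<Longrightarrow> continuous_on UNIV F"
  by (cases k) (auto intro!: continuous_at_imp_continuous_on differentiable_imp_continuous_within)

lemma C_k_Suc_imp: "C_k (Suc k) F \<Longrightarrow> C_k k F"
proof (induction k arbitrary: F)
  case 0
  then show ?case using C_k_continuous[OF 0] by simp
next
  case (Suc k)
  then show ?case unfolding C_k.simps(2)[of "Suc k"] C_k.simps(2)[of k F] by blast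
qed

lemma C_k_mono: "C_k k F \<Longrightarrow> l \<le> k \<Longrightarrow> C_k l F"
  by (induction k) (auto simp: le_Suc_eq simp del: C_k.simps dest: C_k_Suc_imp)

lemma smooth_family_components_bounded:
  fixes X :: "real \<Rightarrow> real \<Rightarrow> 'a::euclidean_space"
  assumes "\<And>b. b \<in> Basis \<Longrightarrow> smooth_family h0 k (\<lambda>h c. X h c \<bullet> b)"
  shows "\<exists>R. \<forall>h\<in>{0<..h0}. \<forall>c\<in>{0..1}. norm (X h c) \<le> R"
proof -
  have "\<exists>C. \<forall>h\<in>{0<..h0}. \<forall>c\<in>{0..1}. \<bar>X h c \<bullet> b\<bar> \<le> C" if "b \<in> Basis" for b
    by (rule smooth_family_bounded[OF assms[OF that]]) blast
  then obtain C where C: "\<And>b h c. b \<in> Basis \<Longrightarrow> h \<in> {0<..h0} \<Longrightarrow> c \<in> {0..1} \<Longrightarrow> \<bar>X h c \<bullet> b\<bar> \<le> C b"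
    by metis
  have "norm (X h c) \<le> (\<Sum>b\<in>Basis. C b)" if "h \<in> {0<..h0}" "c \<in> {0..1}" for h c
    by (rule order_trans[OF norm_le_l1]) (intro sum_mono C that)
  then show ?thesis by blast
qed

lemma continuous_bounded_on_cball:
  fixes F :: "'a::euclidean_space \<Rightarrow> real"
  assumes "continuous_on UNIV F"
  shows "\<exists>C\<ge>0. \<forall>x\<in>cball 0 R. \<bar>F x\<bar> \<le> C"
proof -
  have "compact (F ` cball 0 R)"
    by (intro compact_continuous_image continuous_on_subset[OF assms]) auto
  then obtain C where C: "\<forall>x\<in>cball 0 R. \<bar>F x\<bar> \<le> C"
    by (auto dest!: compact_imp_bounded simp: bounded_iff)
  then show ?thesis
    by (intro exI[of _ "max C 0"]) (auto intro: max.coboundedI1)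
qed

text \<open>By the chain rule the derivative is a sum of products of directional derivatives of \<open>F\<close>, which are of
class \<open>C_k\<close> with one order less, and of the derivatives of the components; hence the induction runs over all
\<open>F\<close> simultaneously.\<close>

lemma smooth_family_compose:
  fixes X :: "real \<Rightarrow> real \<Rightarrow> 'a::euclidean_space" and F :: "'a \<Rightarrow> real"
  assumes "C_k k F" "\<And>b. b \<in> Basis \<Longrightarrow> smooth_family h0 k (\<lambda>h c. X h c \<bullet> b)"
  shows "smooth_family h0 k (\<lambda>h c. F (X h c))"
  using assms
proof (induction k arbitrary: F)
  case 0
  obtain R where R: "\<And>h c. h \<in> {0<..h0} \<Longrightarrow> c \<in> {0..1} \<Longrightarrow> norm (X h c) \<le> R"
    using smooth_family_components_bounded[OF 0(2)] by blast
  obtain C where C: "\<And>x. x \<in> cball 0 R \<Longrightarrow> \<bar>F x\<bar> \<le> C"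
    using continuous_bounded_on_cball[OF C_k_continuous[OF 0(1)], of R] by blast
  have "continuous_on {0..1} (X h)" if "h \<in> {0<..h0}" for h
    unfolding continuous_on_componentwise[of _ "X h"]
    using smooth_family_continuous[OF 0(2) that] by blast
  then show ?case unfolding smooth_family.simps(1)
    using continuous_on_compose2[OF C_k_continuous[OF 0(1)] _ subset_UNIV] C R
    by (intro conjI ballI exI[of _ C]) auto
next
  case (Suc k)
  obtain R where R: "\<And>h c. h \<in> {0<..h0} \<Longrightarrow> c \<in> {0..1} \<Longrightarrow> norm (X h c) \<le> R"
    using smooth_family_components_bounded[OF Suc.prems(2)] by blast
  obtain C where C: "\<And>x. x \<in> cball 0 R \<Longrightarrow> \<bar>F x\<bar> \<le> C"
    using continuous_bounded_on_cball[OF C_k_continuous[OF Suc.prems(1)], of R] by blast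
  have "\<forall>b\<in>Basis. \<exists>v. smooth_family h0 k v \<and> (\<forall>h\<in>{0<..h0}. \<forall>c\<in>{0..1}.
      ((\<lambda>c. X h c \<bullet> b) has_real_derivative h * v h c) (at c within {0..1}))"
    using Suc.prems(2) unfolding smooth_family.simps(2) by blast
  from bchoice[OF this] obtain v where v:
    "\<forall>b\<in>Basis. smooth_family h0 k (v b) \<and> (\<forall>h\<in>{0<..h0}. \<forall>c\<in>{0..1}.
      ((\<lambda>c. X h c \<bullet> b) has_real_derivative h * v b h c) (at c within {0..1}))"
    by (rule exE)
  have diff: "F differentiable at x" and D: "C_k k (\<lambda>x. frechet_derivative F (at x) b)" for x b
    using Suc.prems(1) by auto
  have deriv: "smooth_family h0 k (\<lambda>h c. \<Sum>b\<in>Basis. v b h c * frechet_derivative F (at (X h c)) b)"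
  proof (intro smooth_family_sum smooth_family_mult)
    show "smooth_family h0 k (v b)" if "b \<in> Basis" for b using v that by blast
    show "smooth_family h0 k (\<lambda>h c. frechet_derivative F (at (X h c)) b)" for b
      by (rule Suc.IH[OF D smooth_family_Suc_imp[OF Suc.prems(2)]])
  qed
  show ?case
  proof (rule smooth_family_SucI[OF _ deriv])
    fix h c :: real assume hc: "h \<in> {0<..h0}" "c \<in> {0..1}"
    show "\<bar>F (X h c)\<bar> \<le> C" using C R[OF hc] by simp
    let ?F' = "frechet_derivative F (at (X h c))"
    have F': "(F has_derivative ?F') (at (X h c) within X h ` {0..1})"
      using diff frechet_derivative_works has_derivative_at_withinI by blast
    have lin: "linear ?F'" using F' has_derivative_linear by blast
    have "(X h has_vector_derivative (\<Sum>b\<in>Basis. (h * v b h c) *\<^sub>R b)) (at c within {0..1})"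
      by (intro has_vector_derivative_of_components v[rule_format, THEN conjunct2, rule_format] hc)
    from vector_derivative_diff_chain_within[OF this F']
    have "((\<lambda>c. F (X h c)) has_vector_derivative ?F' (\<Sum>b\<in>Basis. (h * v b h c) *\<^sub>R b)) (at c within {0..1})"
      by (simp add: comp_def)
    also have "?F' (\<Sum>b\<in>Basis. (h * v b h c) *\<^sub>R b) = h * (\<Sum>b\<in>Basis. v b h c * ?F' b)"
      by (simp add: linear_sum[OF lin] linear_scale[OF lin] sum_distrib_left mult_ac)
    finally show "((\<lambda>c. F (X h c)) has_real_derivative h * (\<Sum>b\<in>Basis. v b h c * ?F' b)) (at c within {0..1})"
      by (simp add: has_real_derivative_iff_has_vector_derivative)
  qed
qed

text \<open>Smoothness of order \<open>k\<close> of \<open>X\<close> gives order \<open>k\<close> for the right-hand side of its equation, and hence order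
\<open>k + 1\<close> for \<open>X\<close>. The operator \<open>T\<close> is the truncated Legendre expansion for the numerical solution and the
identity for the exact one.\<close>

lemma smooth_family_bootstrap:
  fixes X :: "real \<Rightarrow> real \<Rightarrow> 'a::euclidean_space"
  assumes F: "\<And>b. b \<in> Basis \<Longrightarrow> C_k n (F b)"
    and T: "\<And>k u. smooth_family h0 k u \<Longrightarrow> smooth_family h0 k (\<lambda>h. T (u h))"
    and X0: "\<And>b. b \<in> Basis \<Longrightarrow> smooth_family h0 0 (\<lambda>h c. X h c \<bullet> b)"
    and X': "\<And>b h c. b \<in> Basis \<Longrightarrow> h \<in> {0<..h0} \<Longrightarrow> c \<in> {0..1} \<Longrightarrow>
      ((\<lambda>c. X h c \<bullet> b) has_real_derivative h * T (\<lambda>x. F b (X h x)) c) (at c within {0..1})"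
    and b: "b \<in> Basis"
  shows "smooth_family h0 n (\<lambda>h c. X h c \<bullet> b)"
proof -
  have "\<forall>b\<in>Basis. smooth_family h0 k (\<lambda>h c. X h c \<bullet> b)" if "k \<le> n" for k
    using that
  proof (induction k)
    case 0
    then show ?case using X0 by blast
  next
    case (Suc k)
    then have IH: "\<And>b. b \<in> Basis \<Longrightarrow> smooth_family h0 k (\<lambda>h c. X h c \<bullet> b)" by auto
    show ?case
    proof
      fix b :: 'a assume b: "b \<in> Basis"
      obtain C where C: "C \<ge> 0" "\<And>h c. h \<in> {0<..h0} \<Longrightarrow> c \<in> {0..1} \<Longrightarrow> \<bar>X h c \<bullet> b\<bar> \<le> C"
        by (rule smooth_family_bounded[OF IH[OF b]]) (rule that)
      have "smooth_family h0 k (\<lambda>h. T (\<lambda>x. F b (X h x)))"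
        using Suc.prems by (intro T smooth_family_compose[OF C_k_mono[OF F[OF b]] IH]) simp_all
      from smooth_family_SucI[OF C(2) this X'[OF b]]
      show "smooth_family h0 (Suc k) (\<lambda>h c. X h c \<bullet> b)" .
    qed
  qed
  then show ?thesis using b by blast
qed

section \<open>A priori bound of the error\<close>

lemma norm_le_of_vector_derivative_bound:
  fixes E :: "real \<Rightarrow> 'a::real_normed_vector"
  assumes "\<And>c. c \<in> {0..1} \<Longrightarrow> (E has_vector_derivative G c) (at c within {0..1})"
    and "\<And>c. c \<in> {0..1} \<Longrightarrow> norm (G c) \<le> B" and "E 0 = 0" and s: "s \<in> {0..1}"
  shows "norm (E s) \<le> B"
proof -
  have "norm (E s - E 0) \<le> B * norm (s - 0)"
  proof (rule differentiable_bound[of "{0..1}" E "\<lambda>c x. x *\<^sub>R G c"])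
    fix c :: real assume c: "c \<in> {0..1}"
    show "(E has_derivative (\<lambda>x. x *\<^sub>R G c)) (at c within {0..1})"
      using assms(1)[OF c] by (simp add: has_vector_derivative_def)
    show "onorm (\<lambda>x. x *\<^sub>R G c) \<le> B"
    proof (rule onorm_le)
      show "norm (x *\<^sub>R G c) \<le> B * norm x" for x
        using mult_right_mono[OF assms(2)[OF c] norm_ge_zero[of x]] by (simp add: mult.commute)
    qed
  qed (use s in auto)
  also have "\<dots> \<le> B * 1"
    using s order_trans[OF norm_ge_zero assms(2)[OF s]] by (intro mult_left_mono) auto
  finally show ?thesis using assms(3) by simp
qed

text \<open>On an interval with \<open>h * L \<le> 1 / 2\<close> the term \<open>L * norm (E h c)\<close> can be absorbed into the left-hand side
at the point where the norm is largest. For larger \<open>h\<close> the a priori bound \<open>B\<close> suffices, as then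
\<open>1 \<le> (2 * L * h) ^ Suc n\<close>.\<close>

lemma small_interval_gronwall:
  fixes E G :: "real \<Rightarrow> real \<Rightarrow> 'a::real_normed_vector"
  assumes "L \<ge> 0" "C \<ge> 0" "B \<ge> 0"
    and E0: "\<And>h. h \<in> {0<..h0} \<Longrightarrow> E h 0 = 0"
    and E': "\<And>h c. h \<in> {0<..h0} \<Longrightarrow> c \<in> {0..1} \<Longrightarrow>
        (E h has_vector_derivative h *\<^sub>R G h c) (at c within {0..1})"
    and G: "\<And>h c. h \<in> {0<..h0} \<Longrightarrow> c \<in> {0..1} \<Longrightarrow> norm (G h c) \<le> L * norm (E h c) + C * h ^ n"
    and B: "\<And>h c. h \<in> {0<..h0} \<Longrightarrow> c \<in> {0..1} \<Longrightarrow> norm (E h c) \<le> B"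
  shows "\<exists>K\<ge>0. \<forall>h\<in>{0<..h0}. \<forall>c\<in>{0..1}. norm (E h c) \<le> K * h ^ Suc n"
proof -
  define K where "K = max (2 * C) (B * (2 * L) ^ Suc n)"
  have "norm (E h c) \<le> K * h ^ Suc n" if h: "h \<in> {0<..h0}" and c: "c \<in> {0..1}" for h c
  proof (cases "h * L \<le> 1 / 2")
    case True
    have "continuous_on {0..1} (E h)"
      unfolding continuous_on_eq_continuous_within
      using has_vector_derivative_continuous[OF E'[OF h]] by blast
    then have "continuous_on {0..1} (\<lambda>c. norm (E h c))" by (intro continuous_intros)
    then obtain s where s: "s \<in> {0..1}" "\<And>c. c \<in> {0..1} \<Longrightarrow> norm (E h c) \<le> norm (E h s)"
      using continuous_attains_sup[of "{0..1::real}" "\<lambda>c. norm (E h c)"] by auto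
    have "norm (E h s) \<le> h * (L * norm (E h s) + C * h ^ n)"
    proof (rule norm_le_of_vector_derivative_bound[OF E'[OF h] _ E0[OF h] s(1)])
      fix c :: real assume c: "c \<in> {0..1}"
      have "norm (G h c) \<le> L * norm (E h s) + C * h ^ n"
        using G[OF h c] mult_left_mono[OF s(2)[OF c] \<open>L \<ge> 0\<close>] by linarith
      then show "norm (h *\<^sub>R G h c) \<le> h * (L * norm (E h s) + C * h ^ n)"
        using h by (simp add: mult_left_mono)
    qed
    also have "\<dots> = (h * L) * norm (E h s) + C * h ^ Suc n" by (simp add: algebra_simps)
    also have "\<dots> \<le> 1 / 2 * norm (E h s) + C * h ^ Suc n"
      using True by (intro add_right_mono mult_right_mono) auto
    finally have "norm (E h s) \<le> 2 * C * h ^ Suc n" by simp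
    also have "\<dots> \<le> K * h ^ Suc n" using h by (intro mult_right_mono) (auto simp: K_def)
    finally show ?thesis using s(2)[OF c] by linarith
  next
    case False
    then have "1 \<le> 2 * L * h" by (simp add: not_le mult_ac)
    then have "1 \<le> (2 * L * h) ^ Suc n" by (rule one_le_power)
    then have "B * 1 \<le> B * (2 * L * h) ^ Suc n" using \<open>B \<ge> 0\<close> by (intro mult_left_mono)
    then have "norm (E h c) \<le> B * (2 * L) ^ Suc n * h ^ Suc n"
      using B[OF h c] by (simp only: power_mult_distrib mult.assoc mult_1_right)
    also have "\<dots> \<le> K * h ^ Suc n" using h by (intro mult_right_mono) (auto simp: K_def)
    finally show ?thesis .
  qed
  moreover have "K \<ge> 0" unfolding K_def using \<open>C \<ge> 0\<close> by simp
  ultimately show ?thesis by blast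
qed

section \<open>Linearization on balls\<close>

lemma linear_functional_abs_le:
  fixes A :: "'a::euclidean_space \<Rightarrow> real"
  assumes "linear A"
  shows "\<bar>A v\<bar> \<le> (\<Sum>b\<in>Basis. \<bar>A b\<bar>) * norm v"
proof -
  have "A v = A (\<Sum>b\<in>Basis. (v \<bullet> b) *\<^sub>R b)" by (simp add: euclidean_representation)
  also have "\<dots> = (\<Sum>b\<in>Basis. (v \<bullet> b) * A b)"
    by (simp add: linear_sum[OF assms] linear_scale[OF assms])
  also have "\<bar>\<dots>\<bar> \<le> (\<Sum>b\<in>Basis. \<bar>A b\<bar> * norm v)"
    by (intro order_trans[OF sum_abs] sum_mono)
      (simp add: abs_mult mult.commute[of "\<bar>A _\<bar>"] Basis_le_norm mult_right_mono)
  finally show ?thesis by (simp add: sum_distrib_right)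
qed

lemma differentiable_imp_linear_frechet:
  "F differentiable at x \<Longrightarrow> linear (frechet_derivative F (at x))"
  using frechet_derivative_works has_derivative_linear by blast

lemma C_1_frechet_bound:
  fixes F :: "'a::euclidean_space \<Rightarrow> real"
  assumes "C_k 1 F"
  shows "\<exists>L\<ge>0. \<forall>x\<in>cball 0 R. \<forall>v. \<bar>frechet_derivative F (at x) v\<bar> \<le> L * norm v"
proof -
  have "\<exists>C\<ge>0. \<forall>x\<in>cball 0 R. \<bar>frechet_derivative F (at x) b\<bar> \<le> C" for b
    using assms by (intro continuous_bounded_on_cball) (simp add: numeral_eq_Suc)
  then have "\<forall>b. \<exists>C\<ge>0. \<forall>x\<in>cball 0 R. \<bar>frechet_derivative F (at x) b\<bar> \<le> C" by (rule allI)
  from choice[OF this] obtain C where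
    C: "\<forall>b. C b \<ge> 0 \<and> (\<forall>x\<in>cball 0 R. \<bar>frechet_derivative F (at x) b\<bar> \<le> C b)"
    by (rule exE)
  have "\<bar>frechet_derivative F (at x) v\<bar> \<le> (\<Sum>b\<in>Basis. C b) * norm v" if "x \<in> cball 0 R" for x v
  proof -
    have "linear (frechet_derivative F (at x))"
      using assms by (intro differentiable_imp_linear_frechet) simp
    from linear_functional_abs_le[OF this]
    have "\<bar>frechet_derivative F (at x) v\<bar> \<le> (\<Sum>b\<in>Basis. \<bar>frechet_derivative F (at x) b\<bar>) * norm v" .
    also have "\<dots> \<le> (\<Sum>b\<in>Basis. C b) * norm v"
      using C that by (intro mult_right_mono sum_mono) auto
    finally show ?thesis .
  qed
  moreover have "(\<Sum>b\<in>Basis. C b) \<ge> 0" using C by (intro sum_nonneg) blast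
  ultimately show ?thesis by blast
qed

lemma C_1_lipschitz_cball:
  fixes F :: "'a::euclidean_space \<Rightarrow> real"
  assumes "C_k 1 F"
  shows "\<exists>L\<ge>0. \<forall>x\<in>cball 0 R. \<forall>y\<in>cball 0 R. \<bar>F y - F x\<bar> \<le> L * norm (y - x)"
proof -
  obtain L where L: "L \<ge> 0" "\<forall>x\<in>cball 0 R. \<forall>v. \<bar>frechet_derivative F (at x) v\<bar> \<le> L * norm v"
    using C_1_frechet_bound[OF assms] by blast
  have "norm (F y - F x) \<le> L * norm (y - x)" if "x \<in> cball 0 R" "y \<in> cball 0 R" for x y
  proof (rule differentiable_bound[of "cball 0 R" F "\<lambda>x. frechet_derivative F (at x)"])
    fix x :: 'a assume x: "x \<in> cball 0 R"
    have "F differentiable at x" using assms by simp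
    then show "(F has_derivative frechet_derivative F (at x)) (at x within cball 0 R)"
      using frechet_derivative_works has_derivative_at_withinI by blast
    show "onorm (frechet_derivative F (at x)) \<le> L" using L x by (intro onorm_le) simp
  qed (use that in auto)
  then show ?thesis using L(1) by auto
qed

text \<open>The mean value inequality on the segment from \<open>x\<close> to \<open>y\<close> for \<open>F\<close> minus its linearization at \<open>y\<close>, whose
derivative is Lipschitz and vanishes at \<open>y\<close>.\<close>

lemma C_2_linearization_cball:
  fixes F :: "'a::euclidean_space \<Rightarrow> real"
  assumes "C_k 2 F"
  shows "\<exists>L\<ge>0. \<forall>x\<in>cball 0 R. \<forall>y\<in>cball 0 R.
    \<bar>F y - F x - frechet_derivative F (at y) (y - x)\<bar> \<le> L * (norm (y - x))\<^sup>2"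
proof -
  let ?D = "\<lambda>x. frechet_derivative F (at x)"
  have C1: "C_k 1 F" and D1: "C_k 1 (\<lambda>x. ?D x b)" for b
    using assms C_k_Suc_imp[of 1 F] by (auto simp: numeral_2_eq_2)
  have "\<exists>L\<ge>0. \<forall>x\<in>cball 0 R. \<forall>y\<in>cball 0 R. \<bar>?D y b - ?D x b\<bar> \<le> L * norm (y - x)" for b
    by (rule C_1_lipschitz_cball[OF D1])
  then have "\<forall>b. \<exists>L\<ge>0. \<forall>x\<in>cball 0 R. \<forall>y\<in>cball 0 R. \<bar>?D y b - ?D x b\<bar> \<le> L * norm (y - x)"
    by (rule allI)
  from choice[OF this] obtain L where L: "\<forall>b. L b \<ge> 0 \<and>
    (\<forall>x\<in>cball 0 R. \<forall>y\<in>cball 0 R. \<bar>?D y b - ?D x b\<bar> \<le> L b * norm (y - x))"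
    by (rule exE)
  define K where "K = (\<Sum>b\<in>Basis. L b)"
  have K0: "K \<ge> 0" unfolding K_def using L by (intro sum_nonneg) blast
  have "\<bar>F y - F x - ?D y (y - x)\<bar> \<le> K * (norm (y - x))\<^sup>2"
    if x: "x \<in> cball 0 R" and y: "y \<in> cball 0 R" for x y
  proof -
    have diff: "F differentiable at z" for z using C1 by simp
    have lin: "linear (?D z)" for z by (intro differentiable_imp_linear_frechet diff)
    have seg: "closed_segment x y \<subseteq> cball 0 R"
      using x y by (intro closed_segment_subset) auto
    have "norm ((F y - ?D y y) - (F x - ?D y x)) \<le> (K * norm (y - x)) * norm (y - x)"
    proof (rule differentiable_bound[of "closed_segment x y" "\<lambda>z. F z - ?D y z" "\<lambda>z v. ?D z v - ?D y v"])
      fix z assume z: "z \<in> closed_segment x y"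
      have "(F has_derivative ?D z) (at z)" using diff frechet_derivative_works by blast
      moreover have "(?D y has_derivative ?D y) (at z)"
        using lin by (intro linear_imp_has_derivative)
      ultimately show "((\<lambda>z. F z - ?D y z) has_derivative (\<lambda>v. ?D z v - ?D y v)) (at z within closed_segment x y)"
        by (rule has_derivative_at_withinI[OF has_derivative_diff])
      show "onorm (\<lambda>v. ?D z v - ?D y v) \<le> K * norm (y - x)"
      proof (rule onorm_le)
        fix v
        have "\<bar>?D z v - ?D y v\<bar> \<le> (\<Sum>b\<in>Basis. \<bar>?D z b - ?D y b\<bar>) * norm v"
          using linear_compose_sub[OF lin lin] by (rule linear_functional_abs_le)
        also have "\<dots> \<le> (\<Sum>b\<in>Basis. L b * norm (z - y)) * norm v"
          using z seg y by (intro mult_right_mono sum_mono L[rule_format, THEN conjunct2, rule_format]) auto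
        also have "\<dots> = K * norm (z - y) * norm v"
          by (simp add: K_def sum_distrib_right)
        also have "\<dots> \<le> K * norm (y - x) * norm v"
          using segment_bound(2)[OF z] K0
          by (intro mult_right_mono mult_left_mono) (auto simp: norm_minus_commute)
        finally show "norm (?D z v - ?D y v) \<le> K * norm (y - x) * norm v" by simp
      qed
    qed auto
    then show ?thesis
      by (simp add: linear_diff[OF lin] power2_eq_square algebra_simps)
  qed
  then show ?thesis using K0 by blast
qed


text \<open>For \<open>k = 0\<close> the derivative is merely continuous, and the remainder is estimated by the size of its parts.
With an increment of the size \<open>O(h ^ (k + 2))\<close> either exponent gives at least the order
\<open>2 * k + 2\<close>.\<close>

lemma linearization_error_cball:
  fixes F :: "'a::euclidean_space \<Rightarrow> real"
  assumes "C_k (Suc k) F"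
  shows "\<exists>L\<ge>0. \<forall>x\<in>cball 0 R. \<forall>y\<in>cball 0 R.
    \<bar>F y - F x - frechet_derivative F (at y) (y - x)\<bar> \<le> L * norm (y - x) ^ (if k = 0 then 1 else 2)"
proof (cases "k = 0")
  case True
  then have C1: "C_k 1 F" using assms by simp
  obtain L where L: "L \<ge> 0" "\<forall>x\<in>cball 0 R. \<forall>y\<in>cball 0 R. \<bar>F y - F x\<bar> \<le> L * norm (y - x)"
    using C_1_lipschitz_cball[OF C1] by blast
  obtain M where M: "M \<ge> 0" "\<forall>y\<in>cball 0 R. \<forall>v. \<bar>frechet_derivative F (at y) v\<bar> \<le> M * norm v"
    using C_1_frechet_bound[OF C1] by blast
  have "\<bar>F y - F x - frechet_derivative F (at y) (y - x)\<bar> \<le> (L + M) * norm (y - x)"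
    if "x \<in> cball 0 R" "y \<in> cball 0 R" for x y
  proof -
    have "\<bar>F y - F x\<bar> \<le> L * norm (y - x)"
      "\<bar>frechet_derivative F (at y) (y - x)\<bar> \<le> M * norm (y - x)"
      using L(2) M(2) that by blast+
    then show ?thesis unfolding distrib_right by linarith
  qed
  then show ?thesis using True L(1) M(1) by (intro exI[of _ "L + M"]) simp
next
  case False
  then have "C_k 2 F" using assms by (intro C_k_mono[OF assms]) simp
  then show ?thesis using C_2_linearization_cball[of F R] False by simp
qed

section \<open>Superconvergence at the end point\<close>

lemma integral_add3:
  fixes u v w :: "real \<Rightarrow> real"
  assumes "continuous_on {0..1} u" "continuous_on {0..1} v" "continuous_on {0..1} w"
  shows "integral {0..1} (\<lambda>c. u c + v c + w c) =
    integral {0..1} u + integral {0..1} v + integral {0..1} w"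
proof -
  have i: "u integrable_on {0..1}" "v integrable_on {0..1}" "w integrable_on {0..1}"
    using assms by (auto intro: integrable_continuous_real)
  then show ?thesis
    using integral_add[OF integrable_add[OF i(1,2)] i(3)] integral_add[OF i(1,2)] by simp
qed

text \<open>The coupled linear equations for the components \<open>e b\<close> of the error are perturbed by an orthogonal residual \<open>\<rho>\<close> of order
\<open>k + 1\<close> and by \<open>\<delta>\<close> of order \<open>2 * k + 2\<close>. Although
\<open>e\<close> itself has only the order \<open>k + 2\<close>, its integrals against smooth weights \<open>q\<close> reach the order \<open>2 * k + 2\<close>.

If the weights are \<open>O(h ^ k)\<close>, the trivial estimate is enough; this is the case \<open>m = 0\<close>. Otherwise let \<open>N b\<close>
be the antiderivative of \<open>- q b\<close> that vanishes at 1. Since \<open>e b\<close> vanishes at 0, integration by parts replaces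
\<open>q b * e b\<close> by \<open>N b\<close> times the derivative of \<open>e b\<close>. Three terms arise. In the \<open>A\<close>-term the error is tested
against new weights, smaller by a factor \<open>h\<close>. In the \<open>\<rho>\<close>-term the weight \<open>h * N b\<close> has one more
derivative than \<open>q b\<close>, which is what orthogonality needs to give the order \<open>(k + 1) + (k + 1)\<close>. The
\<open>\<delta>\<close>-term already has the required order.\<close>

lemma error_moment_bound:
  fixes A :: "'i \<Rightarrow> 'i \<Rightarrow> real \<Rightarrow> real \<Rightarrow> real" and e \<rho> \<delta> :: "'i \<Rightarrow> real \<Rightarrow> real \<Rightarrow> real"
  assumes fin: "finite I"
    and A: "\<And>a b. a \<in> I \<Longrightarrow> b \<in> I \<Longrightarrow> smooth_family h0 k (A b a)"
    and e0: "\<And>b h. b \<in> I \<Longrightarrow> h \<in> {0<..h0} \<Longrightarrow> e b h 0 = 0"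
    and e': "\<And>b h c. b \<in> I \<Longrightarrow> h \<in> {0<..h0} \<Longrightarrow> c \<in> {0..1} \<Longrightarrow>
      (e b h has_real_derivative h * ((\<Sum>a\<in>I. A b a h c * e a h c) + \<rho> b h c + \<delta> b h c)) (at c within {0..1})"
    and e_bd: "\<And>b h c. b \<in> I \<Longrightarrow> h \<in> {0<..h0} \<Longrightarrow> c \<in> {0..1} \<Longrightarrow> \<bar>e b h c\<bar> \<le> K * h ^ (k + 2)"
    and \<rho>: "\<And>b h. b \<in> I \<Longrightarrow> h \<in> {0<..h0} \<Longrightarrow> continuous_on {0..1} (\<rho> b h)"
    and \<rho>_bd: "\<And>b h c. b \<in> I \<Longrightarrow> h \<in> {0<..h0} \<Longrightarrow> c \<in> {0..1} \<Longrightarrow> \<bar>\<rho> b h c\<bar> \<le> K\<rho> * h ^ Suc k"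
    and \<rho>_orth: "\<And>b h a. b \<in> I \<Longrightarrow> h \<in> {0<..h0} \<Longrightarrow>
      integral {0..1} (\<lambda>c. (\<Sum>i<Suc k. a i * c ^ i) * \<rho> b h c) = 0"
    and \<delta>: "\<And>b h. b \<in> I \<Longrightarrow> h \<in> {0<..h0} \<Longrightarrow> continuous_on {0..1} (\<delta> b h)"
    and \<delta>_bd: "\<And>b h c. b \<in> I \<Longrightarrow> h \<in> {0<..h0} \<Longrightarrow> c \<in> {0..1} \<Longrightarrow> \<bar>\<delta> b h c\<bar> \<le> K\<delta> * h ^ (2 * k + 2)"
    and K: "K\<delta> \<ge> 0"
    and q: "\<And>b. b \<in> I \<Longrightarrow> smooth_family h0 k (q b)"
    and q_bd: "\<And>b h c. b \<in> I \<Longrightarrow> h \<in> {0<..h0} \<Longrightarrow> c \<in> {0..1} \<Longrightarrow> \<bar>q b h c\<bar> \<le> Q * h ^ n"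
    and n: "n + m = k"
  shows "\<exists>C. \<forall>h\<in>{0<..h0}. \<bar>\<Sum>b\<in>I. integral {0..1} (\<lambda>c. q b h c * e b h c)\<bar> \<le> C * h ^ (2 * k + 2)"
  using q q_bd n
proof (induction m arbitrary: n q Q)
  case 0
  have ce: "continuous_on {0..1} (e b h)" if "b \<in> I" "h \<in> {0<..h0}" for b h
    by (rule DERIV_continuous_on[OF e'[OF that]])
  have "\<bar>\<Sum>b\<in>I. integral {0..1} (\<lambda>c. q b h c * e b h c)\<bar> \<le> (\<Sum>b\<in>I. Q * K) * h ^ (2 * k + 2)"
    if h: "h \<in> {0<..h0}" for h
    unfolding sum_distrib_right
  proof (intro order_trans[OF sum_abs] sum_mono)
    fix b assume b: "b \<in> I"
    have "\<bar>integral {0..1} (\<lambda>c. q b h c * e b h c)\<bar> \<le> (Q * h ^ n) * (K * h ^ (k + 2))"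
      by (rule abs_integral_mult_le[OF smooth_family_continuous[OF 0(1)[OF b] h] ce[OF b h]
            0(2)[OF b h] e_bd[OF b h]])
    also have "2 * k + 2 = n + (k + 2)" using 0(3) by simp
    then have "(Q * h ^ n) * (K * h ^ (k + 2)) = Q * K * h ^ (2 * k + 2)"
      by (simp only: power_add mult_ac)
    finally show "\<bar>integral {0..1} (\<lambda>c. q b h c * e b h c)\<bar> \<le> Q * K * h ^ (2 * k + 2)" .
  qed
  then show ?case by blast
next
  case (Suc m)
  have ce: "continuous_on {0..1} (e b h)" if "b \<in> I" "h \<in> {0<..h0}" for b h
    by (rule DERIV_continuous_on[OF e'[OF that]])
  note cq = smooth_family_continuous[OF Suc.prems(1)]
  define N where "N b h c = integral {0..1} (q b h) - integral {0..c} (q b h)" for b h c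
  have N': "(N b h has_real_derivative - q b h c) (at c within {0..1})"
    if "b \<in> I" "h \<in> {0<..h0}" "c \<in> {0..1}" for b h c
    unfolding N_def
    using integral_has_real_derivative[OF cq[OF that(1,2)] that(3)]
    by (auto intro!: derivative_eq_intros)
  have N1: "N b h 1 = 0" for b h by (simp add: N_def)
  have cN: "continuous_on {0..1} (N b h)" if "b \<in> I" "h \<in> {0<..h0}" for b h
    by (rule DERIV_continuous_on[OF N'[OF that]])
  \<comment> \<open>The weights \<open>q'\<close> below gain their factor \<open>h\<close> because \<open>N\<close> is as small as \<open>q\<close>.\<close>
  have N_bd: "\<bar>N b h c\<bar> \<le> Q * h ^ n" if b: "b \<in> I" and h: "h \<in> {0<..h0}" and c: "c \<in> {0..1}" for b h c
  proof -
    have "norm (N b h c - N b h 1) \<le> (Q * h ^ n) * norm (c - 1)"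
      by (rule field_differentiable_bound[of "{0..1}" "N b h" "\<lambda>c. - q b h c"])
        (use N'[OF b h] Suc.prems(2)[OF b h] c in auto)
    also have "\<dots> \<le> (Q * h ^ n) * 1"
      using c order_trans[OF abs_ge_zero Suc.prems(2)[OF b h c]] by (intro mult_left_mono) auto
    finally show ?thesis by (simp add: N1)
  qed
  have hN: "smooth_family h0 (Suc k) (\<lambda>h c. h * N b h c)" if b: "b \<in> I" for b
  proof -
    obtain C where C: "C \<ge> 0" "\<And>h c. h \<in> {0<..h0} \<Longrightarrow> c \<in> {0..1} \<Longrightarrow> \<bar>q b h c\<bar> \<le> C"
      by (rule smooth_family_bounded[OF Suc.prems(1)[OF b]]) (rule that)
    have "smooth_family h0 k (\<lambda>h c. - 1 * q b h c)"
      by (intro smooth_family_mult smooth_family_const Suc.prems(1) b)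
    then show ?thesis
    proof (rule smooth_family_SucI[rotated])
      fix h c :: real assume h: "h \<in> {0<..h0}" and c: "c \<in> {0..1}"
      have "\<bar>N b h c\<bar> \<le> \<bar>Q\<bar> * h0 ^ n"
        using h by (intro order_trans[OF N_bd[OF b h c]] mult_mono power_mono) auto
      then show "\<bar>h * N b h c\<bar> \<le> h0 * (\<bar>Q\<bar> * h0 ^ n)"
        using h by (simp add: abs_mult mult_mono)
      show "((\<lambda>c. h * N b h c) has_real_derivative h * (- 1 * q b h c)) (at c within {0..1})"
        using DERIV_cmult[OF N'[OF b h c]] by simp
    qed
  qed
  note cA = smooth_family_continuous[OF A]
  define q' where "q' a h c = (\<Sum>b\<in>I. h * N b h c * A b a h c)" for a h c
  have q': "smooth_family h0 k (q' a)" if "a \<in> I" for a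
    unfolding q'_def
    by (intro smooth_family_sum smooth_family_mult[OF smooth_family_Suc_imp[OF hN]] A that)
  have "\<exists>C\<ge>0. \<forall>h\<in>{0<..h0}. \<forall>c\<in>{0..1}. \<bar>A b a h c\<bar> \<le> C" if "a \<in> I" "b \<in> I" for a b
    by (rule smooth_family_bounded[OF A[OF that]]) blast
  then have "\<forall>p\<in>I\<times>I. \<exists>C\<ge>0. \<forall>h\<in>{0<..h0}. \<forall>c\<in>{0..1}. \<bar>A (fst p) (snd p) h c\<bar> \<le> C"
    by auto
  from bchoice[OF this] obtain CA where CA:
    "\<forall>p\<in>I\<times>I. CA p \<ge> 0 \<and> (\<forall>h\<in>{0<..h0}. \<forall>c\<in>{0..1}. \<bar>A (fst p) (snd p) h c\<bar> \<le> CA p)"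
    by (rule exE)
  define Q' where "Q' = (\<Sum>p\<in>I\<times>I. \<bar>Q\<bar> * CA p)"
  have q'_bd: "\<bar>q' a h c\<bar> \<le> Q' * h ^ Suc n" if a: "a \<in> I" and h: "h \<in> {0<..h0}" and c: "c \<in> {0..1}" for a h c
  proof -
    have "\<bar>q' a h c\<bar> \<le> (\<Sum>b\<in>I. \<bar>Q\<bar> * CA (b, a) * h ^ Suc n)"
      unfolding q'_def
    proof (intro order_trans[OF sum_abs] sum_mono)
      fix b assume b: "b \<in> I"
      have A1: "\<bar>A b a h c\<bar> \<le> CA (b, a)" using CA a b h c by auto
      have "\<bar>N b h c\<bar> \<le> \<bar>Q\<bar> * h ^ n"
        using h by (intro order_trans[OF N_bd[OF b h c]] mult_right_mono) auto
      then have "(h * \<bar>N b h c\<bar>) * \<bar>A b a h c\<bar> \<le> (h * (\<bar>Q\<bar> * h ^ n)) * CA (b, a)"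
        using h A1 by (intro mult_mono mult_left_mono mult_nonneg_nonneg) auto
      then show "\<bar>h * N b h c * A b a h c\<bar> \<le> \<bar>Q\<bar> * CA (b, a) * h ^ Suc n"
        using h by (simp add: abs_mult mult_ac)
    qed
    also have "\<dots> \<le> (\<Sum>a\<in>I. \<Sum>b\<in>I. \<bar>Q\<bar> * CA (b, a) * h ^ Suc n)"
      using CA h fin a
      by (intro member_le_sum[of a I "\<lambda>a. \<Sum>b\<in>I. \<bar>Q\<bar> * CA (b, a) * h ^ Suc n"] sum_nonneg) auto
    also have "\<dots> = Q' * h ^ Suc n"
      unfolding Q'_def sum.cartesian_product' sum_distrib_right
      by (subst sum.swap) (simp add: case_prod_beta)
    finally show ?thesis .
  qed
  \<comment> \<open>The \<open>A\<close>-term is again an error moment, with weights smaller by a factor \<open>h\<close>.\<close>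
  have "Suc n + m = k" using Suc.prems(3) by simp
  from Suc.IH[where q = q' and Q = Q' and n = "Suc n", OF q' q'_bd this] obtain C1 where C1:
    "\<And>h. h \<in> {0<..h0} \<Longrightarrow> \<bar>\<Sum>a\<in>I. integral {0..1} (\<lambda>c. q' a h c * e a h c)\<bar> \<le> C1 * h ^ (2 * k + 2)"
    by blast
  have "\<exists>C. \<forall>h\<in>{0<..h0}. \<bar>integral {0..1} (\<lambda>c. h * N b h c * \<rho> b h c)\<bar> \<le> C * h ^ (2 * k + 2)"
    if b: "b \<in> I" for b
  proof -
    obtain C where C: "C \<ge> 0" "\<forall>h\<in>{0<..h0}. \<forall>w M. continuous_on {0..1} w \<longrightarrow>
      (\<forall>c\<in>{0..1}. \<bar>w c\<bar> \<le> M) \<longrightarrow> (\<forall>a. integral {0..1} (\<lambda>c. (\<Sum>i<Suc k. a i * c ^ i) * w c) = 0) \<longrightarrow>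
      \<bar>integral {0..1} (\<lambda>c. h * N b h c * w c)\<bar> \<le> C * h ^ Suc k * M"
      using smooth_family_orthogonal_bound[OF hN[OF b]] by (elim exE conjE)
    have "\<bar>integral {0..1} (\<lambda>c. h * N b h c * \<rho> b h c)\<bar> \<le> (C * K\<rho>) * h ^ (2 * k + 2)"
      if h: "h \<in> {0<..h0}" for h
    proof -
      have "\<bar>integral {0..1} (\<lambda>c. h * N b h c * \<rho> b h c)\<bar> \<le> C * h ^ Suc k * (K\<rho> * h ^ Suc k)"
        using C(2)[rule_format, OF h \<rho>[OF b h] \<rho>_bd[OF b h] \<rho>_orth[OF b h]] .
      also have "2 * k + 2 = Suc k + Suc k" by simp
      then have "C * h ^ Suc k * (K\<rho> * h ^ Suc k) = (C * K\<rho>) * h ^ (2 * k + 2)"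
        by (simp only: power_add mult_ac)
      finally show ?thesis .
    qed
    then show ?thesis by blast
  qed
  then have "\<forall>b\<in>I. \<exists>C. \<forall>h\<in>{0<..h0}. \<bar>integral {0..1} (\<lambda>c. h * N b h c * \<rho> b h c)\<bar> \<le> C * h ^ (2 * k + 2)"
    by blast
  from bchoice[OF this] obtain C2 where C2:
    "\<forall>b\<in>I. \<forall>h\<in>{0<..h0}. \<bar>integral {0..1} (\<lambda>c. h * N b h c * \<rho> b h c)\<bar> \<le> C2 b * h ^ (2 * k + 2)"
    by (rule exE)
  have \<delta>_int: "\<bar>integral {0..1} (\<lambda>c. h * N b h c * \<delta> b h c)\<bar> \<le> (h0 * (\<bar>Q\<bar> * h0 ^ n) * K\<delta>) * h ^ (2 * k + 2)"
    if b: "b \<in> I" and h: "h \<in> {0<..h0}" for b h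
  proof -
    have bd: "\<bar>h * N b h c\<bar> \<le> h0 * (\<bar>Q\<bar> * h0 ^ n)" if c: "c \<in> {0..1}" for c
    proof -
      have "\<bar>N b h c\<bar> \<le> \<bar>Q\<bar> * h0 ^ n"
        using h by (intro order_trans[OF N_bd[OF b h c]] mult_mono power_mono) auto
      then show ?thesis using h by (simp add: abs_mult mult_mono)
    qed
    have "continuous_on {0..1} (\<lambda>c. h * N b h c)" by (intro continuous_intros cN b h)
    from abs_integral_mult_le[OF this \<delta>[OF b h] bd \<delta>_bd[OF b h]] show ?thesis
      by (simp only: mult.assoc)
  qed
  have identity: "(\<Sum>b\<in>I. integral {0..1} (\<lambda>c. q b h c * e b h c)) =
      (\<Sum>a\<in>I. integral {0..1} (\<lambda>c. q' a h c * e a h c)) +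
      (\<Sum>b\<in>I. integral {0..1} (\<lambda>c. h * N b h c * \<rho> b h c)) +
      (\<Sum>b\<in>I. integral {0..1} (\<lambda>c. h * N b h c * \<delta> b h c))" if h: "h \<in> {0<..h0}" for h
  proof -
    have by_parts: "integral {0..1} (\<lambda>c. q b h c * e b h c) =
        (\<Sum>a\<in>I. integral {0..1} (\<lambda>c. h * N b h c * A b a h c * e a h c)) +
        integral {0..1} (\<lambda>c. h * N b h c * \<rho> b h c) +
        integral {0..1} (\<lambda>c. h * N b h c * \<delta> b h c)" if b: "b \<in> I" for b
    proof -
      let ?g = "\<lambda>c. (\<Sum>a\<in>I. A b a h c * e a h c) + \<rho> b h c + \<delta> b h c"
      have cg: "continuous_on {0..1} ?g"
        by (intro continuous_intros cA ce \<rho> \<delta> b h)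
      have "((\<lambda>c. N b h c * (h * ?g c) - q b h c * e b h c) has_integral
          (N b h 1 * e b h 1 - N b h 0 * e b h 0)) {0..1}"
      proof (rule fundamental_theorem_of_calculus)
        fix c :: real assume c: "c \<in> {0..1}"
        show "((\<lambda>c. N b h c * e b h c) has_vector_derivative N b h c * (h * ?g c) - q b h c * e b h c)
            (at c within {0..1})"
          using DERIV_mult[OF N'[OF b h c] e'[OF b h c]]
          unfolding has_real_derivative_iff_has_vector_derivative by (simp add: algebra_simps)
      qed simp
      then have "integral {0..1} (\<lambda>c. N b h c * (h * ?g c) - q b h c * e b h c) = 0"
        using N1 e0[OF b h] by (simp add: integral_unique)
      moreover have "integral {0..1} (\<lambda>c. N b h c * (h * ?g c) - q b h c * e b h c) =
          integral {0..1} (\<lambda>c. N b h c * (h * ?g c)) - integral {0..1} (\<lambda>c. q b h c * e b h c)"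
        by (intro integral_diff integrable_continuous_real continuous_on_mult continuous_on_const
            cg cN cq ce b h)
      ultimately have "integral {0..1} (\<lambda>c. q b h c * e b h c) = integral {0..1} (\<lambda>c. N b h c * (h * ?g c))"
        by simp
      also have "\<dots> = integral {0..1} (\<lambda>c. (\<Sum>a\<in>I. h * N b h c * A b a h c * e a h c) +
          h * N b h c * \<rho> b h c + h * N b h c * \<delta> b h c)"
        by (intro integral_cong) (simp add: algebra_simps sum_distrib_left)
      also have "\<dots> = integral {0..1} (\<lambda>c. \<Sum>a\<in>I. h * N b h c * A b a h c * e a h c) +
          integral {0..1} (\<lambda>c. h * N b h c * \<rho> b h c) + integral {0..1} (\<lambda>c. h * N b h c * \<delta> b h c)"
        by (intro integral_add3 continuous_intros cA cN ce \<rho> \<delta> b h)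
      also have "integral {0..1} (\<lambda>c. \<Sum>a\<in>I. h * N b h c * A b a h c * e a h c) =
          (\<Sum>a\<in>I. integral {0..1} (\<lambda>c. h * N b h c * A b a h c * e a h c))"
        by (intro integral_sum fin integrable_continuous_real continuous_intros cA cN ce b h)
      finally show ?thesis .
    qed
    have "integral {0..1} (\<lambda>c. q' a h c * e a h c) =
        (\<Sum>b\<in>I. integral {0..1} (\<lambda>c. h * N b h c * A b a h c * e a h c))" if a: "a \<in> I" for a
      unfolding q'_def sum_distrib_right
      by (intro integral_sum fin integrable_continuous_real continuous_intros cA cN ce a h)
    then have "(\<Sum>a\<in>I. integral {0..1} (\<lambda>c. q' a h c * e a h c)) =
        (\<Sum>b\<in>I. \<Sum>a\<in>I. integral {0..1} (\<lambda>c. h * N b h c * A b a h c * e a h c))"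
      by (subst sum.swap) simp
    then show ?thesis by (simp add: by_parts sum.distrib)
  qed
  have "\<bar>\<Sum>b\<in>I. integral {0..1} (\<lambda>c. q b h c * e b h c)\<bar> \<le>
      (C1 + (\<Sum>b\<in>I. C2 b) + (\<Sum>b\<in>I. h0 * (\<bar>Q\<bar> * h0 ^ n) * K\<delta>)) * h ^ (2 * k + 2)" if h: "h \<in> {0<..h0}" for h
  proof -
    have "\<bar>\<Sum>b\<in>I. integral {0..1} (\<lambda>c. h * N b h c * \<rho> b h c)\<bar> \<le> (\<Sum>b\<in>I. C2 b * h ^ (2 * k + 2))"
      by (rule order_trans[OF sum_abs]) (intro sum_mono C2[rule_format] h)
    moreover have "\<bar>\<Sum>b\<in>I. integral {0..1} (\<lambda>c. h * N b h c * \<delta> b h c)\<bar> \<le>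
        (\<Sum>b\<in>I. (h0 * (\<bar>Q\<bar> * h0 ^ n) * K\<delta>) * h ^ (2 * k + 2))"
      by (rule order_trans[OF sum_abs]) (intro sum_mono \<delta>_int h)
    ultimately show ?thesis
      using C1[OF h] unfolding identity[OF h] distrib_right sum_distrib_right by linarith
  qed
  then show ?case by blast
qed

text \<open>Integrating the equation gives \<open>e b h 1\<close> as \<open>h\<close> times three integrals. Only those of the \<open>A\<close>-term and of \<open>\<delta>\<close>
remain, since \<open>\<rho>\<close> is orthogonal to constants.\<close>

lemma endpoint_error_bound:
  fixes A :: "'i \<Rightarrow> 'i \<Rightarrow> real \<Rightarrow> real \<Rightarrow> real" and e \<rho> \<delta> :: "'i \<Rightarrow> real \<Rightarrow> real \<Rightarrow> real"
  assumes fin: "finite I"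
    and A: "\<And>a b. a \<in> I \<Longrightarrow> b \<in> I \<Longrightarrow> smooth_family h0 k (A b a)"
    and e0: "\<And>b h. b \<in> I \<Longrightarrow> h \<in> {0<..h0} \<Longrightarrow> e b h 0 = 0"
    and e': "\<And>b h c. b \<in> I \<Longrightarrow> h \<in> {0<..h0} \<Longrightarrow> c \<in> {0..1} \<Longrightarrow>
      (e b h has_real_derivative h * ((\<Sum>a\<in>I. A b a h c * e a h c) + \<rho> b h c + \<delta> b h c)) (at c within {0..1})"
    and e_bd: "\<And>b h c. b \<in> I \<Longrightarrow> h \<in> {0<..h0} \<Longrightarrow> c \<in> {0..1} \<Longrightarrow> \<bar>e b h c\<bar> \<le> K * h ^ (k + 2)"
    and \<rho>: "\<And>b h. b \<in> I \<Longrightarrow> h \<in> {0<..h0} \<Longrightarrow> continuous_on {0..1} (\<rho> b h)"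
    and \<rho>_bd: "\<And>b h c. b \<in> I \<Longrightarrow> h \<in> {0<..h0} \<Longrightarrow> c \<in> {0..1} \<Longrightarrow> \<bar>\<rho> b h c\<bar> \<le> K\<rho> * h ^ Suc k"
    and \<rho>_orth: "\<And>b h a. b \<in> I \<Longrightarrow> h \<in> {0<..h0} \<Longrightarrow>
      integral {0..1} (\<lambda>c. (\<Sum>i<Suc k. a i * c ^ i) * \<rho> b h c) = 0"
    and \<delta>: "\<And>b h. b \<in> I \<Longrightarrow> h \<in> {0<..h0} \<Longrightarrow> continuous_on {0..1} (\<delta> b h)"
    and \<delta>_bd: "\<And>b h c. b \<in> I \<Longrightarrow> h \<in> {0<..h0} \<Longrightarrow> c \<in> {0..1} \<Longrightarrow> \<bar>\<delta> b h c\<bar> \<le> K\<delta> * h ^ (2 * k + 2)"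
    and K: "K\<delta> \<ge> 0"
    and b: "b \<in> I"
  shows "\<exists>C. \<forall>h\<in>{0<..h0}. \<bar>e b h 1\<bar> \<le> C * h ^ (2 * k + 3)"
proof -
  obtain Q where Q: "\<And>a h c. a \<in> I \<Longrightarrow> h \<in> {0<..h0} \<Longrightarrow> c \<in> {0..1} \<Longrightarrow> \<bar>A b a h c\<bar> \<le> Q"
  proof -
    have "\<exists>C\<ge>0. \<forall>h\<in>{0<..h0}. \<forall>c\<in>{0..1}. \<bar>A b a h c\<bar> \<le> C" if "a \<in> I" for a
      by (rule smooth_family_bounded[OF A[OF that b]]) blast
    then have "\<forall>a\<in>I. \<exists>C\<ge>0. \<forall>h\<in>{0<..h0}. \<forall>c\<in>{0..1}. \<bar>A b a h c\<bar> \<le> C" by blast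
    from bchoice[OF this] obtain C where
      C: "\<forall>a\<in>I. C a \<ge> 0 \<and> (\<forall>h\<in>{0<..h0}. \<forall>c\<in>{0..1}. \<bar>A b a h c\<bar> \<le> C a)" by (rule exE)
    show ?thesis
    proof (rule that[of "\<Sum>a\<in>I. C a"])
      fix h c :: real and a assume *: "a \<in> I" "h \<in> {0<..h0}" "c \<in> {0..1}"
      have "\<bar>A b a h c\<bar> \<le> C a" using C * by blast
      also have "\<dots> \<le> (\<Sum>a\<in>I. C a)" using C fin *(1) by (intro member_le_sum) auto
      finally show "\<bar>A b a h c\<bar> \<le> (\<Sum>a\<in>I. C a)" .
    qed
  qed
  have "\<exists>C. \<forall>h\<in>{0<..h0}. \<bar>\<Sum>a\<in>I. integral {0..1} (\<lambda>c. A b a h c * e a h c)\<bar> \<le> C * h ^ (2 * k + 2)"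
  proof (rule error_moment_bound[where A = A and \<rho> = \<rho> and \<delta> = \<delta> and n = 0 and m = k and Q = Q])
    show "\<bar>A b a h c\<bar> \<le> Q * h ^ 0" if "a \<in> I" "h \<in> {0<..h0}" "c \<in> {0..1}" for a h c
      using Q[OF that] by simp
  qed (fact | simp add: A b)+
  then obtain C where C: "\<And>h. h \<in> {0<..h0} \<Longrightarrow>
      \<bar>\<Sum>a\<in>I. integral {0..1} (\<lambda>c. A b a h c * e a h c)\<bar> \<le> C * h ^ (2 * k + 2)"
    by blast
  have "\<bar>e b h 1\<bar> \<le> (C + K\<delta>) * h ^ (2 * k + 3)" if h: "h \<in> {0<..h0}" for h
  proof -
    let ?g = "\<lambda>c. (\<Sum>a\<in>I. A b a h c * e a h c) + \<rho> b h c + \<delta> b h c"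
    have ce: "continuous_on {0..1} (e a h)" if "a \<in> I" for a
      by (rule DERIV_continuous_on[OF e'[OF that h]])
    have cA: "continuous_on {0..1} (A b a h)" if "a \<in> I" for a
      by (rule smooth_family_continuous[OF A[OF that b] h])
    have "((\<lambda>c. h * ?g c) has_integral (e b h 1 - e b h 0)) {0..1}"
      using e'[OF b h] by (intro fundamental_theorem_of_calculus)
        (auto simp: has_real_derivative_iff_has_vector_derivative)
    then have "e b h 1 = h * integral {0..1} ?g"
      using e0[OF b h] by (simp add: has_integral_iff)
    also have "integral {0..1} ?g = integral {0..1} (\<lambda>c. \<Sum>a\<in>I. A b a h c * e a h c) +
        integral {0..1} (\<rho> b h) + integral {0..1} (\<delta> b h)"
      by (intro integral_add3 continuous_intros cA ce \<rho> \<delta> b h)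
    also have "integral {0..1} (\<rho> b h) = 0"
      \<comment> \<open>these coefficients make the test polynomial the constant 1\<close>
      using \<rho>_orth[OF b h, of "\<lambda>i. if i = 0 then 1 else 0"]
      unfolding sum.lessThan_Suc_shift by simp
    also have "integral {0..1} (\<lambda>c. \<Sum>a\<in>I. A b a h c * e a h c) =
        (\<Sum>a\<in>I. integral {0..1} (\<lambda>c. A b a h c * e a h c))"
      by (intro integral_sum fin integrable_continuous_real continuous_intros cA ce)
    finally have "\<bar>e b h 1\<bar> = h * \<bar>(\<Sum>a\<in>I. integral {0..1} (\<lambda>c. A b a h c * e a h c)) + integral {0..1} (\<delta> b h)\<bar>"
      using h by (simp add: abs_mult)
    also have "\<bar>integral {0..1} (\<delta> b h)\<bar> \<le> K\<delta> * h ^ (2 * k + 2)"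
      using abs_integral_mult_le[OF continuous_on_const \<delta>[OF b h] _ \<delta>_bd[OF b h], of 1 1] by simp
    then have "h * \<bar>(\<Sum>a\<in>I. integral {0..1} (\<lambda>c. A b a h c * e a h c)) + integral {0..1} (\<delta> b h)\<bar>
        \<le> h * (C * h ^ (2 * k + 2) + K\<delta> * h ^ (2 * k + 2))"
      using C[OF h] h by (intro mult_left_mono order_trans[OF abs_triangle_ineq] add_mono) auto
    also have "\<dots> = (C + K\<delta>) * h ^ (2 * k + 3)"
      by (simp add: algebra_simps power_add power2_eq_square power3_eq_cube)
    finally show ?thesis .
  qed
  then show ?thesis by blast
qed

section \<open>The order of the truncated Legendre method\<close>

lemma has_derivative_rescaled_component:
  fixes w :: "real \<Rightarrow> 'a::euclidean_space"
  assumes w: "(w has_vector_derivative d) (at (t0 + c * h) within {t0..t0 + h})"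
    and "h > 0" "c \<in> {0..1}"
  shows "((\<lambda>c. w (t0 + c * h) \<bullet> b) has_real_derivative h * (d \<bullet> b)) (at c within {0..1})"
proof -
  have "(\<lambda>c. t0 + c * h) ` {0..1} \<subseteq> {t0..t0 + h}"
    using \<open>h > 0\<close> by (auto intro: mult_left_le_one_le)
  then have "(w has_vector_derivative d) (at (t0 + c * h) within (\<lambda>c. t0 + c * h) ` {0..1})"
    using has_vector_derivative_within_subset[OF w] by blast
  moreover have "((\<lambda>c. t0 + c * h) has_vector_derivative h) (at c within {0..1})"
    by (auto intro!: derivative_eq_intros)
  ultimately have "((\<lambda>c. w (t0 + c * h)) has_vector_derivative h *\<^sub>R d) (at c within {0..1})"
    using vector_diff_chain_within[of "\<lambda>c. t0 + c * h" h c "{0..1}" w d] by (simp add: comp_def)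
  from bounded_linear.has_vector_derivative[OF bounded_linear_inner_left this, of b]
  show ?thesis by (simp add: has_real_derivative_iff_has_vector_derivative)
qed

lemma legendre_term_inner:
  assumes "continuous_on {0..1} (\<lambda>\<tau>. f (u (t0 + \<tau> * h)))"
  shows "legendre_term f t0 h u c j \<bullet> b =
    (2 * real j + 1) * shifted_legendre j c * legendre_coeff (\<lambda>\<tau>. f (u (t0 + \<tau> * h)) \<bullet> b) j"
proof -
  have "(\<lambda>\<tau>. shifted_legendre j \<tau> *\<^sub>R f (u (t0 + \<tau> * h))) integrable_on {0..1}"
    by (intro integrable_continuous_real continuous_intros assms)
  from integral_linear[OF this bounded_linear_inner_left[of b]]
  show ?thesis by (simp add: legendre_term_def legendre_coeff_def comp_def)
qed

text \<open>Translation of the two equations to rescaled time, one component at a time, and verification of the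
hypotheses of \<open>endpoint_error_bound\<close> with \<open>k = r - 1\<close>. The weights there are the entries of
the Jacobian along \<open>Y\<close>, which are smooth of order \<open>r - 1\<close>.\<close>

lemma truncated_legendre_error:
  fixes f :: "'a::euclidean_space \<Rightarrow> 'a"
  assumes f_smooth: "\<And>b. C_k r (\<lambda>z. f z \<bullet> b)"
    and r: "r \<ge> 1"
    and hmax: "hmax > 0"
    and \<omega>_sol: "\<And>h. 0 < h \<Longrightarrow> h \<le> hmax \<Longrightarrow> truncated_solution f r t0 y0 h (\<omega> h)"
    and \<omega>_bdd: "bounded (\<Union>h\<in>{0<..hmax}. \<omega> h ` {t0..t0 + h})"
    and y_sol: "\<And>h. 0 < h \<Longrightarrow> h \<le> hmax \<Longrightarrow> series_solution f t0 y0 h y"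
  shows "(\<lambda>h. norm (y (t0 + h) - \<omega> h (t0 + h))) \<in> O[at_right 0](\<lambda>h. h ^ (2 * r + 1))"
proof -
  obtain k where rk: "r = Suc k" using r by (cases r) auto
  define F where "F b z = f z \<bullet> b" for b z
  define X where "X h c = \<omega> h (t0 + c * h)" for h c
  define Y where "Y h c = y (t0 + c * h)" for h c
  have FC: "C_k r (F b)" for b using f_smooth[of b] by (simp add: F_def[abs_def])
  have cF: "continuous_on S (F b)" for b S
    by (rule continuous_on_subset[OF C_k_continuous[OF FC]]) simp
  have cf: "continuous_on S f" for S
    unfolding continuous_on_componentwise[of _ f] using cF[of S] by (simp add: F_def[abs_def])

  have \<omega>': "(\<omega> h has_vector_derivative (\<Sum>j<r. legendre_term f t0 h (\<omega> h) c j))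
      (at (t0 + c * h) within {t0..t0 + h})" if "h \<in> {0<..hmax}" "c \<in> {0..1}" for h c
    using \<omega>_sol[of h] that unfolding truncated_solution_def by simp
  have cX: "continuous_on {0..1} (X h)" if h: "h \<in> {0<..hmax}" for h
    unfolding continuous_on_componentwise[of _ "X h"] X_def
    by (intro ballI DERIV_continuous_on[OF has_derivative_rescaled_component[OF \<omega>'[OF h]]])
      (use h in auto)
  have X': "((\<lambda>c. X h c \<bullet> b) has_real_derivative h * legendre_proj r (\<lambda>x. F b (X h x)) c)
      (at c within {0..1})" if h: "h \<in> {0<..hmax}" and c: "c \<in> {0..1}" for b h c
  proof -
    have "continuous_on {0..1} (\<lambda>\<tau>. f (\<omega> h (t0 + \<tau> * h)))"
      using continuous_on_compose2[OF cf cX[OF h] subset_UNIV] by (simp add: X_def)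
    then have "(\<Sum>j<r. legendre_term f t0 h (\<omega> h) c j) \<bullet> b = legendre_proj r (\<lambda>x. F b (X h x)) c"
      by (simp add: inner_sum_left legendre_term_inner legendre_proj_def F_def X_def)
    then show ?thesis
      using has_derivative_rescaled_component[OF \<omega>'[OF h c] _ c, of b] h by (simp add: X_def)
  qed

  have y': "\<exists>d. \<forall>c\<in>{0..1}. legendre_term f t0 h y c sums d c \<and>
      (y has_vector_derivative d c) (at (t0 + c * h) within {t0..t0 + h})"
    if "h \<in> {0<..hmax}" for h
    using y_sol[of h] that unfolding series_solution_def by (intro bchoice) simp
  have cY: "continuous_on {0..1} (Y h)" if h: "h \<in> {0<..hmax}" for h
  proof -
    obtain d where d: "\<forall>c\<in>{0..1}. legendre_term f t0 h y c sums d c \<and>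
        (y has_vector_derivative d c) (at (t0 + c * h) within {t0..t0 + h})"
      using y'[OF h] by (rule exE)
    show ?thesis
      unfolding continuous_on_componentwise[of _ "Y h"] Y_def
      by (intro ballI DERIV_continuous_on[OF has_derivative_rescaled_component[OF d[rule_format, THEN conjunct2]]])
        (use h in auto)
  qed
  have Y': "((\<lambda>c. Y h c \<bullet> b) has_real_derivative h * F b (Y h c)) (at c within {0..1})"
    if h: "h \<in> {0<..hmax}" and c: "c \<in> {0..1}" for b h c
  proof -
    obtain d where d: "\<forall>c\<in>{0..1}. legendre_term f t0 h y c sums d c \<and>
        (y has_vector_derivative d c) (at (t0 + c * h) within {t0..t0 + h})"
      using y'[OF h] by (rule exE)
    have cfY: "continuous_on {0..1} (\<lambda>\<tau>. f (y (t0 + \<tau> * h)))"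
      using continuous_on_compose2[OF cf cY[OF h] subset_UNIV] by (simp add: Y_def)
    show ?thesis
    proof (rule has_derivative_of_pointwise_legendre_limit[where d = "\<lambda>c. d c \<bullet> b"])
      show "continuous_on {0..1} (\<lambda>c. F b (Y h c))"
        by (rule continuous_on_compose2[OF cF cY[OF h]]) auto
    next
      fix c :: real assume c: "c \<in> {0..1}"
      have "(\<lambda>n. \<Sum>j<n. legendre_term f t0 h y c j) \<longlonglongrightarrow> d c"
        using d c by (simp add: sums_def)
      then have "(\<lambda>n. (\<Sum>j<n. legendre_term f t0 h y c j) \<bullet> b) \<longlonglongrightarrow> d c \<bullet> b"
        by (intro tendsto_intros)
      then show "(\<lambda>n. legendre_proj n (\<lambda>c. F b (Y h c)) c) \<longlonglongrightarrow> d c \<bullet> b"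
        by (simp add: inner_sum_left legendre_term_inner cfY legendre_proj_def F_def Y_def)
      show "((\<lambda>c. Y h c \<bullet> b) has_real_derivative h * (d c \<bullet> b)) (at c within {0..1})"
        unfolding Y_def using d c h by (intro has_derivative_rescaled_component) auto
    qed (rule c)
  qed

  \<comment> \<open>Boundedness starts the bootstrap. For \<open>Y\<close> it holds because all members sample one function on \<open>[t0, t0 + hmax]\<close>.\<close>
  have X0: "smooth_family hmax 0 (\<lambda>h c. X h c \<bullet> b)" if b: "b \<in> Basis" for b
  proof -
    obtain R where R: "\<And>x. x \<in> (\<Union>h\<in>{0<..hmax}. \<omega> h ` {t0..t0 + h}) \<Longrightarrow> norm x \<le> R"
      using \<omega>_bdd unfolding bounded_iff by blast
    have "\<bar>X h c \<bullet> b\<bar> \<le> R" if h: "h \<in> {0<..hmax}" and c: "c \<in> {0..1}" for h c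
    proof -
      have "t0 + c * h \<in> {t0..t0 + h}" using h c by (auto intro: mult_left_le_one_le)
      then have "norm (X h c) \<le> R" unfolding X_def using h by (intro R) blast
      then show ?thesis using Basis_le_norm[OF b, of "X h c"] by linarith
    qed
    then show ?thesis unfolding smooth_family.simps(1)
      by (intro conjI ballI exI[of _ R] continuous_intros cX)
  qed
  have Y0: "smooth_family hmax 0 (\<lambda>h c. Y h c \<bullet> b)" if b: "b \<in> Basis" for b
  proof -
    have "compact (Y hmax ` {0..1})"
      using hmax by (intro compact_continuous_image cY) auto
    then have "bounded (Y hmax ` {0..1})" by (rule compact_imp_bounded)
    then obtain R where R: "\<And>c. c \<in> {0..1} \<Longrightarrow> norm (Y hmax c) \<le> R"
      unfolding bounded_iff by blast
    have "\<bar>Y h c \<bullet> b\<bar> \<le> R" if h: "h \<in> {0<..hmax}" and c: "c \<in> {0..1}" for h c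
    proof -
      have "c * h \<le> 1 * hmax" using h c by (intro mult_mono) auto
      then have "c * h / hmax \<in> {0..1}" using h c hmax by auto
      from R[OF this] have "norm (Y h c) \<le> R" using hmax by (simp add: Y_def)
      then show ?thesis using Basis_le_norm[OF b, of "Y h c"] by linarith
    qed
    then show ?thesis unfolding smooth_family.simps(1)
      by (intro conjI ballI exI[of _ R] continuous_intros cY)
  qed
  have Xr: "smooth_family hmax r (\<lambda>h c. X h c \<bullet> b)" if "b \<in> Basis" for b
    by (rule smooth_family_bootstrap[where T = "legendre_proj r" and F = F,
          OF FC smooth_family_legendre_proj X0 X' that])
  have Yr: "smooth_family hmax r (\<lambda>h c. Y h c \<bullet> b)" if "b \<in> Basis" for b
    by (rule smooth_family_bootstrap[where T = "\<lambda>u. u" and F = F, OF FC _ Y0 Y' that])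

  define \<rho> where "\<rho> b h c = F b (X h c) - legendre_proj r (\<lambda>x. F b (X h x)) c" for b h c
  have FX: "smooth_family hmax r (\<lambda>h c. F b (X h c))" for b
    by (rule smooth_family_compose[OF FC Xr])
  note cFX = smooth_family_continuous[OF FX]
  have "\<forall>b. \<exists>C\<ge>0. \<forall>h\<in>{0<..hmax}. \<forall>c\<in>{0..1}. \<bar>\<rho> b h c\<bar> \<le> C * h ^ r"
    unfolding \<rho>_def by (intro allI smooth_family_legendre_residual_bound FX)
  from choice[OF this] obtain C\<rho> where C\<rho>:
    "\<forall>b. C\<rho> b \<ge> 0 \<and> (\<forall>h\<in>{0<..hmax}. \<forall>c\<in>{0..1}. \<bar>\<rho> b h c\<bar> \<le> C\<rho> b * h ^ r)" by (rule exE)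
  have c\<rho>: "continuous_on {0..1} (\<rho> b h)" if "h \<in> {0<..hmax}" for b h
    unfolding \<rho>_def by (intro continuous_intros cFX that)
  have \<rho>_orth: "integral {0..1} (\<lambda>c. (\<Sum>i<Suc k. a i * c ^ i) * \<rho> b h c) = 0"
    if "h \<in> {0<..hmax}" for a b h
    unfolding \<rho>_def rk[symmetric]
    by (rule legendre_residual_orthogonal_power_sum[OF cFX[OF that]])

  obtain RX where RX: "\<forall>h\<in>{0<..hmax}. \<forall>c\<in>{0..1}. norm (X h c) \<le> RX"
    using smooth_family_components_bounded[OF Xr] by blast
  obtain RY where RY: "\<forall>h\<in>{0<..hmax}. \<forall>c\<in>{0..1}. norm (Y h c) \<le> RY"
    using smooth_family_components_bounded[OF Yr] by blast
  define R where "R = max RX RY"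
  have inX: "X h c \<in> cball 0 R" and inY: "Y h c \<in> cball 0 R"
    if "h \<in> {0<..hmax}" "c \<in> {0..1}" for h c
    using RX RY that by (auto simp: R_def le_max_iff_disj)

  define E where "E h c = Y h c - X h c" for h c
  have E0: "E h 0 = 0" if "h \<in> {0<..hmax}" for h
    using \<omega>_sol[of h] y_sol[of h] that
    by (simp add: E_def X_def Y_def truncated_solution_def series_solution_def)
  have E': "((\<lambda>c. E h c \<bullet> b) has_real_derivative h * (F b (Y h c) - F b (X h c) + \<rho> b h c))
      (at c within {0..1})" if "h \<in> {0<..hmax}" "c \<in> {0..1}" for b h c
    using DERIV_diff[OF Y'[OF that, of b] X'[OF that, of b]]
    by (simp add: E_def \<rho>_def inner_diff_left algebra_simps)
  \<comment> \<open>The order that the size of the residual alone provides; it is the starting point for the moment estimate.\<close>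
  have "\<exists>K\<ge>0. \<forall>h\<in>{0<..hmax}. \<forall>c\<in>{0..1}. norm (E h c) \<le> K * h ^ Suc r"
  proof -
    have "\<forall>b. \<exists>L\<ge>0. \<forall>x\<in>cball 0 R. \<forall>y\<in>cball 0 R. \<bar>F b y - F b x\<bar> \<le> L * norm (y - x)"
      by (intro allI C_1_lipschitz_cball C_k_mono[OF FC r])
    from choice[OF this] obtain L where
      L: "\<forall>b. L b \<ge> 0 \<and> (\<forall>x\<in>cball 0 R. \<forall>y\<in>cball 0 R. \<bar>F b y - F b x\<bar> \<le> L b * norm (y - x))" by (rule exE)
    show ?thesis
    proof (rule small_interval_gronwall[where B = "RY + RX" and L = "\<Sum>b\<in>Basis. L b" and C = "\<Sum>b\<in>Basis. C\<rho> b"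
          and G = "\<lambda>h c. \<Sum>b\<in>Basis. (F b (Y h c) - F b (X h c) + \<rho> b h c) *\<^sub>R b"])
      show "0 \<le> (\<Sum>b\<in>Basis. L b)" using L by (intro sum_nonneg) blast
      show "0 \<le> (\<Sum>b\<in>Basis. C\<rho> b)" using C\<rho> by (intro sum_nonneg) blast
      show "0 \<le> RY + RX"
        using order_trans[OF norm_ge_zero RX[rule_format, of hmax 0]]
          order_trans[OF norm_ge_zero RY[rule_format, of hmax 0]] hmax by simp
      fix h assume h: "h \<in> {0<..hmax}"
      show "E h 0 = 0" by (rule E0[OF h])
      fix c :: real assume c: "c \<in> {0..1}"
      have "(E h has_vector_derivative (\<Sum>b\<in>Basis. (h * (F b (Y h c) - F b (X h c) + \<rho> b h c)) *\<^sub>R b))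
          (at c within {0..1})"
        by (intro has_vector_derivative_of_components E' h c)
      then show "(E h has_vector_derivative h *\<^sub>R (\<Sum>b\<in>Basis. (F b (Y h c) - F b (X h c) + \<rho> b h c) *\<^sub>R b))
          (at c within {0..1})"
        by (simp add: scaleR_sum_right)
      show "norm (E h c) \<le> RY + RX"
        unfolding E_def using RX RY h c by (intro order_trans[OF norm_triangle_ineq4] add_mono) auto
      have "norm (\<Sum>b\<in>Basis. (F b (Y h c) - F b (X h c) + \<rho> b h c) *\<^sub>R b)
          \<le> (\<Sum>b\<in>Basis. L b * norm (E h c) + C\<rho> b * h ^ r)"
      proof (rule sum_norm_le)
        fix b :: 'a assume b: "b \<in> Basis"
        have "\<bar>F b (Y h c) - F b (X h c)\<bar> \<le> L b * norm (E h c)"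
          unfolding E_def using L inX[OF h c] inY[OF h c] by blast
        moreover have "\<bar>\<rho> b h c\<bar> \<le> C\<rho> b * h ^ r" using C\<rho> h c by blast
        ultimately show "norm ((F b (Y h c) - F b (X h c) + \<rho> b h c) *\<^sub>R b) \<le> L b * norm (E h c) + C\<rho> b * h ^ r"
          using b by simp
      qed
      then show "norm (\<Sum>b\<in>Basis. (F b (Y h c) - F b (X h c) + \<rho> b h c) *\<^sub>R b)
          \<le> (\<Sum>b\<in>Basis. L b) * norm (E h c) + (\<Sum>b\<in>Basis. C\<rho> b) * h ^ r"
        by (simp add: sum.distrib sum_distrib_right)
    qed
  qed
  then obtain K where K: "K \<ge> 0" "\<forall>h\<in>{0<..hmax}. \<forall>c\<in>{0..1}. norm (E h c) \<le> K * h ^ Suc r" by blast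

  \<comment> \<open>The linearization is taken along \<open>Y\<close>, since the bootstrap makes the entries of \<open>A\<close> smooth families there.\<close>
  define A where "A b a h c = frechet_derivative (F b) (at (Y h c)) a" for b a h c
  have DA: "C_k k (\<lambda>x. frechet_derivative (F b) (at x) a)" for a b
    using FC[of b] unfolding rk C_k.simps by blast
  have A: "smooth_family hmax k (A b a)" for a b
    unfolding A_def[abs_def]
    by (rule smooth_family_compose[OF DA]) (rule smooth_family_mono[OF Yr], simp_all add: rk)
  define \<delta> where "\<delta> b h c = F b (Y h c) - F b (X h c) - (\<Sum>a\<in>Basis. A b a h c * (E h c \<bullet> a))" for b h c
  have cE: "continuous_on {0..1} (E h)" if "h \<in> {0<..hmax}" for h
    unfolding E_def by (intro continuous_intros cX cY that)
  have c\<delta>: "continuous_on {0..1} (\<delta> b h)" if h: "h \<in> {0<..hmax}" for b h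
    unfolding \<delta>_def
    by (intro continuous_intros cE h smooth_family_continuous[OF A] continuous_on_compose2[OF cF cY]
        continuous_on_compose2[OF cF cX]) auto
  have \<delta>_eq: "\<delta> b h c = F b (Y h c) - F b (X h c) - frechet_derivative (F b) (at (Y h c)) (Y h c - X h c)" for b h c
  proof -
    have lin: "linear (frechet_derivative (F b) (at (Y h c)))"
      using FC[of b] unfolding rk C_k.simps by (intro differentiable_imp_linear_frechet) blast
    have "frechet_derivative (F b) (at (Y h c)) (\<Sum>a\<in>Basis. (E h c \<bullet> a) *\<^sub>R a) =
        (\<Sum>a\<in>Basis. A b a h c * (E h c \<bullet> a))"
      by (simp add: linear_sum[OF lin] linear_scale[OF lin] A_def mult.commute)
    then show ?thesis by (simp add: \<delta>_def euclidean_representation E_def)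
  qed
  have \<delta>_bd: "\<exists>K\<delta>\<ge>0. \<forall>h\<in>{0<..hmax}. \<forall>c\<in>{0..1}. \<bar>\<delta> b h c\<bar> \<le> K\<delta> * h ^ (2 * k + 2)" for b
  proof -
    \<comment> \<open>the exponent of the increment in \<open>linearization_error_cball\<close>\<close>
    define p :: nat where "p = (if k = 0 then 1 else 2)"
    obtain M where M: "M \<ge> 0" "\<forall>x\<in>cball 0 R. \<forall>y\<in>cball 0 R.
        \<bar>F b y - F b x - frechet_derivative (F b) (at y) (y - x)\<bar> \<le> M * norm (y - x) ^ p"
      using linearization_error_cball[OF FC[of b, unfolded rk]] unfolding p_def by blast
    \<comment> \<open>\<open>m\<close> counts the surplus powers of \<open>h\<close>: none for \<open>k = 0\<close>, and two otherwise.\<close>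
    define m where "m = (k + 2) * p - (2 * k + 2)"
    have p: "(k + 2) * p = (2 * k + 2) + m" unfolding m_def p_def by auto
    have "\<bar>\<delta> b h c\<bar> \<le> (M * K ^ p * hmax ^ m) * h ^ (2 * k + 2)" if h: "h \<in> {0<..hmax}" and c: "c \<in> {0..1}" for h c
    proof -
      have "\<bar>\<delta> b h c\<bar> \<le> M * norm (E h c) ^ p"
        unfolding \<delta>_eq E_def using M(2) inX[OF h c] inY[OF h c] by blast
      also have "\<dots> \<le> M * (K * h ^ (k + 2)) ^ p"
        using K(2)[rule_format, OF h c] M(1) by (intro mult_left_mono power_mono) (auto simp: rk)
      also have "\<dots> = M * K ^ p * (h ^ (2 * k + 2) * h ^ m)"
      proof -
        have "(h ^ (k + 2)) ^ p = h ^ (2 * k + 2) * h ^ m"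
          unfolding power_mult[symmetric] p by (rule power_add)
        then show ?thesis by (simp only: power_mult_distrib mult.assoc)
      qed
      also have "\<dots> \<le> M * K ^ p * (h ^ (2 * k + 2) * hmax ^ m)"
        using M(1) K(1) h by (intro mult_left_mono power_mono) auto
      finally show ?thesis by (simp only: mult_ac)
    qed
    then show ?thesis using M(1) K(1) hmax by (intro exI[of _ "M * K ^ p * hmax ^ m"]) simp
  qed
  then have "\<forall>b. \<exists>K\<delta>\<ge>0. \<forall>h\<in>{0<..hmax}. \<forall>c\<in>{0..1}. \<bar>\<delta> b h c\<bar> \<le> K\<delta> * h ^ (2 * k + 2)" by blast
  from choice[OF this] obtain C\<delta> where
    C\<delta>: "\<forall>b. C\<delta> b \<ge> 0 \<and> (\<forall>h\<in>{0<..hmax}. \<forall>c\<in>{0..1}. \<bar>\<delta> b h c\<bar> \<le> C\<delta> b * h ^ (2 * k + 2))"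
    by (rule exE)

  have "\<exists>C. \<forall>h\<in>{0<..hmax}. \<bar>E h 1 \<bullet> b\<bar> \<le> C * h ^ (2 * k + 3)" if b: "b \<in> Basis" for b
  proof (rule endpoint_error_bound[where I = Basis and A = A and \<rho> = \<rho> and \<delta> = \<delta>
        and e = "\<lambda>b h c. E h c \<bullet> b" and K = K and K\<rho> = "\<Sum>b\<in>Basis. C\<rho> b" and K\<delta> = "\<Sum>b\<in>Basis. C\<delta> b"])
    show "finite (Basis :: 'a set)" by simp
    show "0 \<le> (\<Sum>b\<in>Basis. C\<delta> b)" using C\<delta> by (intro sum_nonneg) blast
    show "smooth_family hmax k (A b a)" for a b by (rule A)
    show "b \<in> Basis" by (rule b)
    fix b :: 'a and h assume b: "b \<in> Basis" and h: "h \<in> {0<..hmax}"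
    show "E h 0 \<bullet> b = 0" by (simp add: E0[OF h])
    show "continuous_on {0..1} (\<rho> b h)" by (rule c\<rho>[OF h])
    show "continuous_on {0..1} (\<delta> b h)" by (rule c\<delta>[OF h])
    show "integral {0..1} (\<lambda>c. (\<Sum>i<Suc k. a i * c ^ i) * \<rho> b h c) = 0" for a
      by (rule \<rho>_orth[OF h])
    fix c :: real assume c: "c \<in> {0..1}"
    show "((\<lambda>c. E h c \<bullet> b) has_real_derivative
        h * ((\<Sum>a\<in>Basis. A b a h c * (E h c \<bullet> a)) + \<rho> b h c + \<delta> b h c)) (at c within {0..1})"
      using E'[OF h c, of b] by (simp add: \<delta>_def algebra_simps)
    show "\<bar>E h c \<bullet> b\<bar> \<le> K * h ^ (k + 2)"
      using K(2)[rule_format, OF h c] Basis_le_norm[OF b, of "E h c"] by (simp add: rk)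
    have "C\<rho> b * h ^ r \<le> (\<Sum>b\<in>Basis. C\<rho> b) * h ^ r"
      using b h C\<rho> by (intro mult_right_mono member_le_sum) auto
    then show "\<bar>\<rho> b h c\<bar> \<le> (\<Sum>b\<in>Basis. C\<rho> b) * h ^ Suc k"
      using C\<rho> h c unfolding rk by (blast intro: order_trans)
    have "C\<delta> b * h ^ (2 * k + 2) \<le> (\<Sum>b\<in>Basis. C\<delta> b) * h ^ (2 * k + 2)"
      using b h C\<delta> by (intro mult_right_mono member_le_sum) auto
    then show "\<bar>\<delta> b h c\<bar> \<le> (\<Sum>b\<in>Basis. C\<delta> b) * h ^ (2 * k + 2)"
      using C\<delta> h c by (blast intro: order_trans)
  qed
  then have "\<forall>b\<in>Basis. \<exists>C. \<forall>h\<in>{0<..hmax}. \<bar>E h 1 \<bullet> b\<bar> \<le> C * h ^ (2 * k + 3)" by blast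
  from bchoice[OF this] obtain C where
    C: "\<forall>b\<in>Basis. \<forall>h\<in>{0<..hmax}. \<bar>E h 1 \<bullet> b\<bar> \<le> C b * h ^ (2 * k + 3)" by (rule exE)
  have "norm (y (t0 + h) - \<omega> h (t0 + h)) \<le> (\<Sum>b\<in>Basis. C b) * h ^ (2 * r + 1)"
    if h: "h \<in> {0<..hmax}" for h
  proof -
    have "norm (E h 1) \<le> (\<Sum>b\<in>Basis. C b * h ^ (2 * k + 3))"
      by (rule order_trans[OF norm_le_l1]) (intro sum_mono C[rule_format] h)
    then show ?thesis by (simp add: E_def X_def Y_def rk sum_distrib_right numeral_eq_Suc)
  qed
  then have "eventually (\<lambda>h. norm (norm (y (t0 + h) - \<omega> h (t0 + h))) \<le>
      (\<Sum>b\<in>Basis. C b) * norm (h ^ (2 * r + 1))) (at_right 0)"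
    unfolding eventually_at_right_field using hmax by (intro exI[of _ hmax]) auto
  then show ?thesis by (rule bigoI)
qed

text \<open>The components of \<open>J \<nabla>H\<close> are directional derivatives of \<open>H\<close>; this is how smoothness of \<open>H\<close>
passes to the vector field.\<close>

lemma hamiltonian_field_inner:
  fixes H :: "real ^ ('m::finite + 'm) \<Rightarrow> real"
  assumes "H differentiable at z"
  shows "(symplectic_J *v gradient H z) \<bullet> b = frechet_derivative H (at z) (b v* symplectic_J)"
proof -
  have "(H has_derivative (\<lambda>v. v \<bullet> gradient H z)) (at z)"
    using gradient_works[OF assms] by (simp add: gderiv_def)
  then have "frechet_derivative H (at z) = (\<lambda>v. v \<bullet> gradient H z)"
    by (rule frechet_derivative_at[symmetric])
  then show ?thesis
    using dot_lmul_matrix[of b symplectic_J "gradient H z"] by (simp add: inner_commute)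
qed

theorem theorem2:
  fixes H :: "real ^ ('m::finite + 'm) \<Rightarrow> real"
    and f :: "real ^ ('m + 'm) \<Rightarrow> real ^ ('m + 'm)"
    and r :: nat
    and t0 hmax :: real
    and y0 :: "real ^ ('m + 'm)"
    and y :: "real \<Rightarrow> real ^ ('m + 'm)"
    and \<omega> :: "real \<Rightarrow> real \<Rightarrow> real ^ ('m + 'm)"
  assumes H_smooth: "C_k (r + 1) H"
    and f_eq: "\<And>z. f z = symplectic_J *v gradient H z"
    and r: "r \<ge> 1"
    and hmax: "hmax > 0"
    and \<omega>_sol: "\<And>h. 0 < h \<Longrightarrow> h \<le> hmax \<Longrightarrow> truncated_solution f r t0 y0 h (\<omega> h)"
    and \<omega>_bdd: "bounded (\<Union>h\<in>{0<..hmax}. \<omega> h ` {t0..t0 + h})"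
    and y_sol: "\<And>h. 0 < h \<Longrightarrow> h \<le> hmax \<Longrightarrow> series_solution f t0 y0 h y"
  shows "(\<lambda>h. norm (y (t0 + h) - \<omega> h (t0 + h))) \<in> O[at_right 0](\<lambda>h. h ^ (2 * r + 1))"
proof (rule truncated_legendre_error[OF _ r hmax \<omega>_sol \<omega>_bdd y_sol])
  fix b
  have "H differentiable at z" and "C_k r (\<lambda>z. frechet_derivative H (at z) (b v* symplectic_J))" for z
    using H_smooth by auto
  then show "C_k r (\<lambda>z. f z \<bullet> b)" by (simp add: f_eq hamiltonian_field_inner)
qed

end
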